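(* Let $\Lambda=(\boldsymbol\lambda_1^{r_1},\dots,\boldsymbol\lambda_m^{r_m})\vdash\boldsymbol i\in\mathbb N_0^n$ be a multi-index partition, and let $\Lambda_\pi=\varphi(\Lambda)\in\mathcal M_{|\boldsymbol i|}$ be the canonical transformation of $\Lambda$. Let $\mathcal C_\pi$ be the set of all $\vec{\boldsymbol 1}_{|\boldsymbol i|}$-partitions complementary to $\Lambda_\pi$, let $\Phi_{\sigma_{\boldsymbol i}}$ be the reverse transformation under the labeling rule $\sigma_{\boldsymbol i}$, and let $$\mathfrak C_\Lambda=\{\tilde\Lambda\vdash\boldsymbol i \mid \Phi_{\sigma_{\boldsymbol i}}(\Lambda_{\tilde\pi})=\tilde\Lambda\ \text{for some}\ \Lambda_{\tilde\pi}\in\mathcal C_\pi\},\qquad a_{\tilde\Lambda}=\bigl|\Phi_{\sigma_{\boldsymbol i}}^{-1}(\tilde\Lambda)\cap\mathcal C_\pi\bigr|.$$ Then the generalized multivariate cumulant associated with $\Lambda$ satisfies $$\mathfrak K_\Lambda(\boldsymbol X)=\sum_{\tilde\Lambda=(\tilde{\boldsymbol\lambda}_1^{c_1},\tilde{\boldsymbol\lambda}_2^{c_2},\dots)\in\mathfrak C_\Lambda} a_{\tilde\Lambda}\,[\kappa_{\tilde{\boldsymbol\lambda}_1}(\boldsymbol X)]^{c_1}[\kappa_{\tilde{\boldsymbol\lambda}_2}(\boldsymbol X)]^{c_2}\cdots .$$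
   Context: $\boldsymbol X=(X_1,\dots,X_n)$ is a vector of random variables, not necessarily independent or identically distributed, for which all moments involved exist. Multi-indices: for $\boldsymbol i\in\mathbb N_0^n$, $|\boldsymbol i|=i_1+\dots+i_n$ and $\boldsymbol X^{\boldsymbol i}=X_1^{i_1}\cdots X_n^{i_n}$. A multi-index partition $\Lambda\vdash\boldsymbol i$ is a matrix whose columns are nonzero vectors of $\mathbb N_0^n$ with sum $\boldsymbol i$, arranged in decreasing lexicographic order; $\Lambda=(\boldsymbol\lambda_1^{r_1},\dots,\boldsymbol\lambda_m^{r_m})$ means that the distinct columns are $\boldsymbol\lambda_1>\dots>\boldsymbol\lambda_m$ with multiplicities $r_1,\dots,r_m\ge1$. $\mathcal L_{\boldsymbol i}$ is the set of all $\Lambda\vdash\boldsymbol i$. $\vec{\boldsymbol 1}_p$-partitions: for a set partition $\pi=B_1|\cdots|B_k$ of $[p]=\{1,\dots,p\}$ (blocks in lexicographic order), $\Lambda_\pi$ is the $p\times k$ $0/1$ matrix whose $j$-th column is the indicator vector of $B_j$. $\mathcal M_p$ is the set of all such $\Lambda_\pi$. The column span $V_\pi\subseteq\mathbb R^p$ is the real span of the columns of $\Lambda_\pi$. Two elements $\Lambda_\pi,\Lambda_{\tilde\pi}$ of $\mathcal M_p$ are complementary if $V_\pi\cap V_{\tilde\pi}$ is the line spanned by the all-ones vector (equivalently, the least upper bound of $\pi$ and $\tilde\pi$ in the refinement order is the one-block partition). Canonical transformation $\varphi:\mathcal L_{\boldsymbol i}\to\mathcal M_{|\boldsymbol i|}$: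 it sends $\Lambda=(\boldsymbol\lambda_1^{r_1},\dots,\boldsymbol\lambda_m^{r_m})$ to the $\vec{\boldsymbol 1}_{|\boldsymbol i|}$-partition with columns $\boldsymbol s_1,\dots,\boldsymbol s_{r_1+\cdots+r_m}$ defined as follows. For $u=1,\dots,r_1$, $(\boldsymbol s_u)_j=1$ if $(u-1)|\boldsymbol\lambda_1|+1\le j\le u|\boldsymbol\lambda_1|$ and $0$ otherwise. For $q=2,\dots,m$ and $t=1,\dots,r_q$, with $m_{q,t}=r_1|\boldsymbol\lambda_1|+\cdots+r_{q-1}|\boldsymbol\lambda_{q-1}|+(t-1)|\boldsymbol\lambda_q|$, $(\boldsymbol s_{r_1+\cdots+r_{q-1}+t})_j=1$ if $m_{q,t}+1\le j\le m_{q,t}+|\boldsymbol\lambda_q|$ and $0$ otherwise. (That is, the blocks are consecutive intervals of $[|\boldsymbol i|]$ whose lengths are the sums of the entries of the successive columns of $\Lambda$.) Labeling rule: $\sigma_{\boldsymbol i}:[p]\to[n]$, with $p=|\boldsymbol i|\ge n$, is defined by $\sigma_{\boldsymbol i}^{-1}(k)=\{t_{k-1}+1,\dots,t_k\}$ for $k\in[n]$, where $t_0=0$ and $t_k=\sum_{j=1}^k i_j$. Reverse transformation: $\Phi_{\sigma_{\boldsymbol i}}:\mathcal M_{|\boldsymbol i|}\to\mathcal L_{\boldsymbol i}$ sends $(\boldsymbol s_1,\dots,\boldsymbol s_k)$ to the multi-index partition with columns $\boldsymbol\lambda_1,\dots,\boldsymbol\lambda_k$ (reordered if necessary), where $(\boldsymbol\lambda_q)_j=\sum_{t\in\sigma_{\boldsymbol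 i}^{-1}(j)}(\boldsymbol s_q)_t$ for $j=1,\dots,n$. $\Phi_{\sigma_{\boldsymbol i}}^{-1}(\tilde\Lambda)$ denotes the preimage $\{\Lambda_{\tilde\pi}\in\mathcal M_{|\boldsymbol i|}\mid\Phi_{\sigma_{\boldsymbol i}}(\Lambda_{\tilde\pi})=\tilde\Lambda\}$. Cumulants: the joint cumulant of random variables $Z_1,\dots,Z_k$ is $\mathcal K(Z_1,\dots,Z_k)=\sum_{\rho}(-1)^{|\rho|-1}(|\rho|-1)!\prod_{B\in\rho}\mathbb E\bigl[\prod_{j\in B}Z_j\bigr]$, summed over set partitions $\rho$ of $[k]$, $|\rho|$ being the number of blocks. The multivariate cumulant $\kappa_{\boldsymbol j}(\boldsymbol X)$ is the joint cumulant of the list in which $X_1$ is repeated $j_1$ times, ..., $X_n$ is repeated $j_n$ times. The generalized multivariate cumulant of $\Lambda=(\boldsymbol\lambda_1^{r_1},\dots,\boldsymbol\lambda_m^{r_m})$ is $\mathfrak K_\Lambda(\boldsymbol X)=\mathcal K(\boldsymbol X^{\boldsymbol\lambda_1},\dots,\boldsymbol X^{\boldsymbol\lambda_1},\dots,\boldsymbol X^{\boldsymbol\lambda_m},\dots,\boldsymbol X^{\boldsymbol\lambda_m})$ with $\boldsymbol X^{\boldsymbol\lambda_q}$ repeated $r_q$ times.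
   Formalization: As printed the formula fails, e.g. for Λ=((1,1)^2), i=(2,2). It is proved for σ_i when Φ_{σ_i}(φ(Λ))=Λ, and for every Λ with σ_i replaced by the labeling that applies the rule σ_{λ_q} inside the q-th interval of φ(Λ). *)

theory Defs
  imports
    "HOL-Probability.Probability"
    "HOL-Library.Disjoint_Sets"
    "HOL-Library.List_Lexorder"
begin

text \<open>
  Conventions.  A multi-index in \<open>\<nat>\<^sub>0\<^sup>n\<close> is a list of length \<open>n\<close>; its modulus is its
  \<open>sum_list\<close>.  A matrix is the list of its columns.  Everything is indexed from 0, so that
  \<open>[n]\<close> becomes \<open>{..<n}\<close> and \<open>[p]\<close> becomes \<open>{..<p}\<close>.  The order on lists is the
  lexicographic one of \<open>List_Lexorder\<close>.
\<close>

type_synonym multi_index = "nat list"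
type_synonym columns = "nat list list"

subsection \<open>Multi-index partitions\<close>

text \<open>
  Columns are listed with repetition: \<open>(\<lambda>\<^sub>1\<^bsup>r\<^sub>1\<^esup>, \<dots>, \<lambda>\<^sub>m\<^bsup>r\<^sub>m\<^esup>)\<close> is the
  list with \<open>set \<Lambda> = {\<lambda>\<^sub>1, \<dots>, \<lambda>\<^sub>m}\<close> and \<open>r\<^sub>q = count_list \<Lambda> \<lambda>\<^sub>q\<close>.
\<close>

definition mi_partitions :: "multi_index \<Rightarrow> columns set" where
  "mi_partitions i = {\<Lambda>.
     (\<forall>c\<in>set \<Lambda>. length c = length i \<and> (\<exists>k<length i. c ! k \<noteq> 0)) \<and>
     (\<forall>k<length i. (\<Sum>c\<leftarrow>\<Lambda>. c ! k) = i ! k) \<and>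
     sorted_wrt (\<ge>) \<Lambda>}"

subsection \<open>Partitions of the all-ones vector\<close>

text \<open>
  A block is identified with its increasing enumeration; blocks are ordered
  lexicographically.
\<close>

definition indicator_matrix :: "nat \<Rightarrow> nat set set \<Rightarrow> columns" where
  "indicator_matrix p \<pi> =
     map (\<lambda>B. map (\<lambda>t. if t \<in> set B then 1 else 0) [0..<p])
       (sorted_list_of_set (sorted_list_of_set ` \<pi>))"

definition ones_partitions :: "nat \<Rightarrow> columns set" where
  "ones_partitions p = {indicator_matrix p \<pi> | \<pi>. partition_on {..<p} \<pi>}"

definition column_span :: "nat \<Rightarrow> columns \<Rightarrow> real list set" where
  "column_span p S = {v. length v = p \<and>
     (\<exists>c. \<forall>t<p. v ! t = (\<Sum>q<length S. c q * real (S ! q ! t)))}"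

definition complementary :: "nat \<Rightarrow> columns \<Rightarrow> columns \<Rightarrow> bool" where
  "complementary p S S' \<longleftrightarrow>
     column_span p S \<inter> column_span p S' = {replicate p c | c. True}"

definition complements :: "nat \<Rightarrow> columns \<Rightarrow> columns set" where
  "complements p S = {S' \<in> ones_partitions p. complementary p S S'}"

subsection \<open>Canonical and reverse transformations\<close>

text \<open>
  Column \<open>u\<close> of \<open>canonical \<Lambda>\<close> is the indicator vector of the interval of length
  \<open>|\<Lambda> ! u|\<close> that starts right after the intervals of the preceding columns.
\<close>

definition canonical :: "columns \<Rightarrow> columns" where
  "canonical \<Lambda> =
     (let p = sum_list (map sum_list \<Lambda>);
          start = (\<lambda>u. sum_list (map sum_list (take u \<Lambda>)))
      in map (\<lambda>u. map (\<lambda>t. if start u \<le> t \<and> t < start u + sum_list (\<Lambda> ! u) then 1 else 0)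
                    [0..<p])
           [0..<length \<Lambda>])"

text \<open>
  A map \<open>\<sigma>\<close> from positions to variable indices is the list of its values.  The rule
  \<open>labeling i\<close> reads \<open>0\<close> (\<open>i\<^sub>0\<close> times), \<open>1\<close> (\<open>i\<^sub>1\<close> times), and so on;
  \<open>labeling_fibre\<close> gives its fibres.
\<close>

definition labeling :: "multi_index \<Rightarrow> nat list" where
  "labeling i = concat (map (\<lambda>k. replicate (i ! k) k) [0..<length i])"

lemma length_labeling: "length (labeling i) = sum_list i"
  by (simp add: labeling_def length_concat comp_def map_nth)

lemma labeling_snoc: "labeling (j @ [a]) = labeling j @ replicate a (length j)"
proof -
  have "map (\<lambda>k. replicate ((j @ [a]) ! k) k) [0..<length j]
      = map (\<lambda>k. replicate (j ! k) k) [0..<length j]"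
    by (rule map_cong) (auto simp: nth_append)
  then have "concat (map (\<lambda>k. replicate ((j @ [a]) ! k) k) [0..<length j]) = labeling j"
    by (simp only: labeling_def)
  then show ?thesis by (simp add: labeling_def)
qed

lemma labeling_fibre:
  assumes "k < length i"
  shows "{t. t < sum_list i \<and> labeling i ! t = k}
       = {sum_list (take k i)..<sum_list (take (Suc k) i)}"
  using assms
proof (induction i rule: rev_induct)
  case Nil
  then show ?case by simp
next
  case (snoc a j)
  have nth: "labeling (j @ [a]) ! t
      = (if t < sum_list j then labeling j ! t else length j)" if "t < sum_list j + a" for t
    using that by (auto simp: labeling_snoc nth_append length_labeling)
  have small: "labeling j ! t < length j" if "t < sum_list j" for t
  proof -
    have "labeling j ! t \<in> set (labeling j)"
      using that by (intro nth_mem) (simp add: length_labeling)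
    then show ?thesis by (auto simp: labeling_def)
  qed
  show ?case
  proof (cases "k = length j")
    case True
    then show ?thesis using small nth by (fastforce split: if_splits)
  next
    case False
    then have k: "k < length j" using snoc.prems by simp
    have "{t. t < sum_list (j @ [a]) \<and> labeling (j @ [a]) ! t = k}
        = {t. t < sum_list j \<and> labeling j ! t = k}"
      using nth False by (auto split: if_splits)
    then show ?thesis using snoc.IH[OF k] k by simp
  qed
qed

text \<open>
  The same rule applied inside each column: the positions of the \<open>u\<close>-th interval of
  \<open>canonical \<Lambda>\<close> are labelled by \<open>labeling (\<Lambda> ! u)\<close>.  For every
  \<open>\<Lambda> \<in> mi_partitions i\<close> it labels exactly \<open>i ! k\<close> positions by \<open>k\<close>, as
  \<open>labeling i\<close> does, and \<open>reverse_transform\<close> under it sends \<open>canonical \<Lambda>\<close> back to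
  \<open>\<Lambda>\<close>.  Under \<open>labeling i\<close> this can fail: for \<open>\<Lambda> = [[1,1],[1,1]]\<close>,
  \<open>canonical \<Lambda>\<close> goes to \<open>[[2,0],[0,2]]\<close>, and the corresponding expansion is that of
  \<open>\<K>(X\<^sub>0\<^sup>2, X\<^sub>1\<^sup>2)\<close> rather than \<open>\<K>(X\<^sub>0 X\<^sub>1, X\<^sub>0 X\<^sub>1)\<close>.
\<close>

definition columnwise_labeling :: "columns \<Rightarrow> nat list" where
  "columnwise_labeling \<Lambda> = concat (map labeling \<Lambda>)"

definition reverse_transform :: "nat \<Rightarrow> nat list \<Rightarrow> columns \<Rightarrow> columns" where
  "reverse_transform n \<sigma> S =
     rev (sort (map (\<lambda>s. map (\<lambda>k. \<Sum>t | t < length \<sigma> \<and> \<sigma> ! t = k. s ! t) [0..<n]) S))"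

text \<open>
  In the following two definitions \<open>S\<close> is the partition of the all-ones vector whose
  complements are taken.
\<close>

definition complement_images :: "multi_index \<Rightarrow> nat list \<Rightarrow> columns \<Rightarrow> columns set" where
  "complement_images i \<sigma> S = {\<Lambda> \<in> mi_partitions i.
     \<exists>S'\<in>complements (sum_list i) S. reverse_transform (length i) \<sigma> S' = \<Lambda>}"

definition complement_count :: "multi_index \<Rightarrow> nat list \<Rightarrow> columns \<Rightarrow> columns \<Rightarrow> nat" where
  "complement_count i \<sigma> S \<Lambda> =
     card ({S' \<in> ones_partitions (sum_list i). reverse_transform (length i) \<sigma> S' = \<Lambda>}
           \<inter> complements (sum_list i) S)"

subsection \<open>Cumulants\<close>

definition mpower :: "(nat \<Rightarrow> 'a \<Rightarrow> real) \<Rightarrow> multi_index \<Rightarrow> 'a \<Rightarrow> real" where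
  "mpower X j = (\<lambda>\<omega>. \<Prod>k<length j. X k \<omega> ^ (j ! k))"

definition joint_cumulant :: "'a measure \<Rightarrow> ('a \<Rightarrow> real) list \<Rightarrow> real" where
  "joint_cumulant M Z =
     (\<Sum>\<rho> | partition_on {..<length Z} \<rho>.
        (-1) ^ (card \<rho> - 1) * fact (card \<rho> - 1) *
        (\<Prod>B\<in>\<rho>. integral\<^sup>L M (\<lambda>\<omega>. \<Prod>j\<in>B. (Z ! j) \<omega>)))"

definition multivariate_cumulant ::
    "'a measure \<Rightarrow> (nat \<Rightarrow> 'a \<Rightarrow> real) \<Rightarrow> multi_index \<Rightarrow> real" where
  "multivariate_cumulant M X j =
     joint_cumulant M (concat (map (\<lambda>k. replicate (j ! k) (X k)) [0..<length j]))"

definition generalized_cumulant ::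
    "'a measure \<Rightarrow> (nat \<Rightarrow> 'a \<Rightarrow> real) \<Rightarrow> columns \<Rightarrow> real" where
  "generalized_cumulant M X \<Lambda> = joint_cumulant M (map (mpower X) \<Lambda>)"

end

theory Submission
  imports Defs "HOL-Combinatorics.List_Permutation"
begin

text \<open>
  Label the positions of \<open>{..<p}\<close> by variables, so that the factor of the \<open>u\<close>-th column is the
  product of the labelled variables over the \<open>u\<close>-th block of the canonical partition \<open>\<pi>\<close>. The
  statement then becomes the Leonov--Shiryaev formula: the joint cumulant of the block products is
  the sum over all partitions \<open>\<tau>\<close> with \<open>\<pi> \<squnion> \<tau> = 1\<close> of the products of the block cumulants, grouped
  by the image of \<open>\<tau>\<close> under the reverse transformation. The formula itself is Moebius inversion in the
  partition lattice: expand every moment in cumulants, exchange the sums, and use that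
  \<open>(-1)\<^bsup>k-1\<^esup> (k-1)!\<close>, \<open>k\<close> the number of blocks, sums to zero over the partitions of a set with
  more than one element, applied to the set of blocks of \<open>\<pi> \<squnion> \<tau>\<close>.
\<close>

subsection \<open>Moebius inversion over set partitions\<close>

text \<open>The Moebius function of the lattice of partitions of a \<open>k\<close>-element set,
  from bottom to top. Truncated subtraction gives the value 1 at \<open>k = 0\<close>, as the sum
  over the partitions of the empty set requires.\<close>

definition moebius_coeff :: "nat \<Rightarrow> real" where
  "moebius_coeff k = (-1) ^ (k - 1) * fact (k - 1)"

lemma moebius_coeff_Suc: "k \<ge> 1 \<Longrightarrow> moebius_coeff (Suc k) = - real k * moebius_coeff k"
  by (cases k) (auto simp: moebius_coeff_def algebra_simps)

text \<open>The argument is a pair so that the function can be applied as an image over a dependent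
  sum: a partition together with one of its blocks.\<close>

definition add_to_block :: "'a \<Rightarrow> 'a set set \<times> 'a set \<Rightarrow> 'a set set" where
  "add_to_block x = (\<lambda>(T, B). insert (insert x B) (T - {B}))"

lemma partition_on_block_unique:
  "partition_on A P \<Longrightarrow> B \<in> P \<Longrightarrow> C \<in> P \<Longrightarrow> x \<in> B \<Longrightarrow> x \<in> C \<Longrightarrow> B = C"
  unfolding partition_on_def disjoint_def by blast

lemma partition_on_block_subset: "partition_on A P \<Longrightarrow> B \<in> P \<Longrightarrow> B \<subseteq> A"
  unfolding partition_on_def by blast

lemma partition_on_block_exists: "partition_on A P \<Longrightarrow> x \<in> A \<Longrightarrow> \<exists>B\<in>P. x \<in> B"
  unfolding partition_on_def by blast

lemma partition_on_block_nonempty: "partition_on A P \<Longrightarrow> B \<in> P \<Longrightarrow> \<exists>x. x \<in> B"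
  by (metis partition_onD3 equals0I)

section \<open>Partitions of a set with one more element\<close>

lemma partition_on_remove:
  assumes P: "partition_on A P" and B: "B \<in> P"
  shows "disjnt B (\<Union> (P - {B}))" and "partition_on (A - B) (P - {B})"
proof -
  show disj: "disjnt B (\<Union> (P - {B}))"
  proof -
    have "C = B" if "C \<in> P" "x \<in> B" "x \<in> C" for x C
      using partition_on_block_unique[OF P that(1) B that(3,2)] .
    then show ?thesis unfolding disjnt_iff by blast
  qed
  have "insert B (P - {B}) = P" using B by blast
  then show "partition_on (A - B) (P - {B})" using P partition_on_insert[OF disj, of A] by simp
qed

lemma partition_on_add_singleton:
  assumes "x \<notin> S" "partition_on S T"
  shows "partition_on (insert x S) (insert {x} T)" "{x} \<notin> T"
  using assms by (auto simp: partition_on_def disjoint_def)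

lemma partition_on_add_to_block:
  assumes "x \<notin> S" "partition_on S T" "B \<in> T"
  shows "partition_on (insert x S) (add_to_block x (T, B))"
    and "{x} \<notin> add_to_block x (T, B)" and "insert x B \<notin> T"
proof -
  have x: "x \<notin> C" "C \<noteq> {}" if "C \<in> T" for C
    using that assms(1) partition_on_block_subset[OF assms(2)] partition_onD3[OF assms(2)] by blast+
  show "insert x B \<notin> T" using x(1) by blast
  show "{x} \<notin> add_to_block x (T, B)"
    using x[OF assms(3)] x(1) by (auto simp: add_to_block_def)
  show "partition_on (insert x S) (add_to_block x (T, B))"
  proof -
    note rem = partition_on_remove[OF assms(2,3)]
    have "disjnt (insert x B) (\<Union> (T - {B}))" using rem(1) x(1) unfolding disjnt_iff by blast
    moreover have "insert x S - insert x B = S - B" using assms(1) by blast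
    ultimately show ?thesis
      using partition_on_insert[of "insert x B" "T - {B}" "insert x S"] rem(2)
        partition_on_block_subset[OF assms(2,3)] by (auto simp: add_to_block_def)
  qed
qed

text \<open>Deleting \<open>x\<close> from a partition either deletes the block \<open>{x}\<close>
  or shrinks a larger block to a nonempty one; the two images record these cases.\<close>

lemma partitions_insert:
  assumes x: "x \<notin> S"
  shows "{P. partition_on (insert x S) P} =
    insert {x} ` {T. partition_on S T} \<union> add_to_block x ` (SIGMA T:{T. partition_on S T}. T)"
    (is "?L = ?R1 \<union> ?R2")
proof (intro equalityI subsetI)
  fix P assume "P \<in> ?L"
  then have P: "partition_on (insert x S) P" by simp
  show "P \<in> ?R1 \<union> ?R2"
  proof (cases "{x} \<in> P")
    case True
    have "partition_on S (P - {{x}})" using partition_on_remove(2)[OF P True] x by simp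
    then show ?thesis using True 
      by (intro UnI1 image_eqI[of _ _ "P - {{x}}"]) auto
  next
    case False
    obtain C where C: "C \<in> P" "x \<in> C" using partition_on_block_exists[OF P] by blast
    define B where "B = C - {x}"
    have neB: "B \<noteq> {}"
    proof
      assume "B = {}"
      then have "C = {x}" using C(2) unfolding B_def by blast
      then show False using C(1) False by simp
    qed
    have disj: "disjnt B (\<Union> (P - {C}))"
      using partition_on_remove(1)[OF P C(1)] unfolding B_def disjnt_iff by blast
    have "insert x S - C = S - B" using C(2) x unfolding B_def by blast
    then have T: "partition_on S (insert B (P - {C}))"
      using partition_on_insert[OF disj, of S] partition_on_remove(2)[OF P C(1)] neB
        partition_on_block_subset[OF P C(1)] unfolding B_def by auto
    have "B \<notin> P - {C}" using neB disj unfolding disjnt_iff by blast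
    then have "P = add_to_block x (insert B (P - {C}), B)"
      using insert_Diff[OF C(2)] insert_Diff[OF C(1)] unfolding add_to_block_def B_def by simp
    then show ?thesis using T by (intro UnI2 image_eqI) auto
  qed
next
  fix P assume "P \<in> ?R1 \<union> ?R2"
  then show "P \<in> ?L"
    using partition_on_add_singleton(1)[OF x] partition_on_add_to_block(1)[OF x] by auto
qed

text \<open>A partition of \<open>S\<close> with \<open>k\<close> blocks extends to
  \<open>insert x S\<close> once with \<open>k + 1\<close> blocks and \<open>k\<close> times with
  \<open>k\<close> blocks. By the recursion for \<open>moebius_coeff\<close> these contributions
  cancel when \<open>k \<ge> 1\<close>, so only an empty \<open>S\<close> leaves something.\<close>

lemma sum_moebius_coeff_partitions:
  assumes "finite S"
  shows "(\<Sum>P | partition_on S P. moebius_coeff (card P)) = (if card S \<le> 1 then 1 else 0)"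
  using assms
proof (induction S rule: finite_induct)
  case empty
  then show ?case by (simp add: partition_on_empty moebius_coeff_def)
next
  case (insert x S)
  let ?T = "{T. partition_on S T}"
  have fT: "finite ?T" by (rule finitely_many_partition_on[OF insert.hyps(1)])
  have fin: "finite T" if "partition_on S T" for T using finite_elements[OF insert.hyps(1) that] .
  have inj1: "inj_on (insert {x}) ?T"
    using partition_on_add_singleton(2)[OF insert.hyps(2)]
    by (metis (mono_tags, lifting) inj_onI insert_ident mem_Collect_eq)
  \<comment> \<open>The inverse finds the unique block containing \<open>x\<close> and removes
    \<open>x\<close> from it.\<close>
  have inj2: "inj_on (add_to_block x) (SIGMA T:?T. T)"
  proof (rule inj_on_inverseI[where g =
        "\<lambda>P. let C = (THE C. C \<in> P \<and> x \<in> C) in (insert (C - {x}) (P - {C}), C - {x})"])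
    fix p assume "p \<in> (SIGMA T:?T. T)"
    then obtain T B where p: "p = (T, B)" and T: "partition_on S T" and B: "B \<in> T" by auto
    have x: "x \<notin> C" if "C \<in> T" for C
      using that T insert.hyps(2) partition_on_block_subset by blast
    have "(THE C. C \<in> add_to_block x (T, B) \<and> x \<in> C) = insert x B"
      using x B by (intro the_equality) (auto simp: add_to_block_def)
    moreover have "insert (insert x B - {x}) (add_to_block x (T, B) - {insert x B}) = T"
      using x[OF B] x B by (auto simp: add_to_block_def)
    ultimately show "(let C = (THE C. C \<in> add_to_block x p \<and> x \<in> C) in
        (insert (C - {x}) (add_to_block x p - {C}), C - {x})) = p"
      using x[OF B] by (simp add: Let_def p)
  qed
  have card2: "card (add_to_block x (T, B)) = card T" if "partition_on S T" "B \<in> T" for T B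
  proof -
    have "card (add_to_block x (T, B)) = Suc (card (T - {B}))"
      using partition_on_add_to_block(3)[OF insert.hyps(2) that] fin[OF that(1)]
      by (simp add: add_to_block_def)
    then show ?thesis using card_Suc_Diff1[OF fin[OF that(1)] that(2)] by simp
  qed
  have "(\<Sum>P | partition_on (insert x S) P. moebius_coeff (card P)) =
      (\<Sum>T\<in>?T. moebius_coeff (card (insert {x} T))) +
      (\<Sum>p\<in>(SIGMA T:?T. T). moebius_coeff (card (add_to_block x p)))"
    unfolding partitions_insert[OF insert.hyps(2)]
  proof (subst sum.union_disjoint)
    show "finite (insert {x} ` ?T)" "finite (add_to_block x ` (SIGMA T:?T. T))"
      using fT fin by auto
    show "insert {x} ` ?T \<inter> add_to_block x ` (SIGMA T:?T. T) = {}"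
      using partition_on_add_to_block(2)[OF insert.hyps(2)] by auto
  qed (simp add: sum.reindex[OF inj1] sum.reindex[OF inj2])
  also have "(\<Sum>T\<in>?T. moebius_coeff (card (insert {x} T))) = (\<Sum>T\<in>?T. moebius_coeff (Suc (card T)))"
    using partition_on_add_singleton(2)[OF insert.hyps(2)] fin by (intro sum.cong) auto
  also have "(\<Sum>p\<in>(SIGMA T:?T. T). moebius_coeff (card (add_to_block x p))) =
      (\<Sum>p\<in>(SIGMA T:?T. T). moebius_coeff (card (fst p)))"
    using card2 by (intro sum.cong) auto
  \<comment> \<open>The summand does not depend on the chosen block, so each \<open>T\<close> counts
    \<open>card T\<close> times.\<close>
  also have "\<dots> = (\<Sum>T\<in>?T. real (card T) * moebius_coeff (card T))"
    using fT fin sum.Sigma[of ?T "\<lambda>T. T" "\<lambda>T B. moebius_coeff (card T)"]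
    by (simp add: case_prod_beta)
  finally have eq: "(\<Sum>P | partition_on (insert x S) P. moebius_coeff (card P)) =
      (\<Sum>T\<in>?T. moebius_coeff (Suc (card T)) + real (card T) * moebius_coeff (card T))"
    by (simp add: sum.distrib)
  show ?case
  proof (cases "S = {}")
    case True
    have "{T. partition_on S T} = {{}}" unfolding True by (simp add: partition_on_empty)
    then show ?thesis unfolding eq by (simp add: True moebius_coeff_def)
  next
    case False
    have "card T \<ge> 1" if "partition_on S T" for T
      using fin[OF that] that False by (cases "T = {}") (auto simp: partition_on_def Suc_le_eq card_gt_0_iff)
    then show ?thesis unfolding eq using False insert.hyps
      by (simp add: moebius_coeff_Suc card_gt_0_iff)
  qed
qed

section \<open>Coarsenings and refinements of a fixed partition\<close>

text \<open>To coarsen \<open>J\<close> is to merge its blocks according to a partition of the set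
  \<open>J\<close>; conversely, \<open>Q\<close> groups the blocks of \<open>J\<close> by the block
  of \<open>Q\<close> containing them. Injectivity of \<open>Union\<close> keeps the number of
  blocks and lets products over them be reindexed.\<close>

lemma bij_betw_coarsenings:
  assumes J: "partition_on A J"
  shows "bij_betw (\<lambda>P. Union ` P) {P. partition_on J P} {Q. refines A J Q}"
    and "\<And>P. partition_on J P \<Longrightarrow> inj_on Union P"
proof -
  \<comment> \<open>A block of \<open>J\<close> inside \<open>\<Union>S\<close> shares a point with
    a member of \<open>S\<close> and hence equals it, so \<open>S\<close> can be read off from its
    union.\<close>
  have sub: "{B \<in> J. B \<subseteq> \<Union>S} = S" if S: "S \<subseteq> J" for S
  proof (intro equalityI subsetI)
    fix B assume B: "B \<in> {B \<in> J. B \<subseteq> \<Union>S}"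
    then obtain y where "y \<in> B" using partition_on_block_nonempty[OF J] by blast
    then obtain C where C: "C \<in> S" "y \<in> C" using B by blast
    have "B = C"
      by (rule partition_on_block_unique[OF J _ _ \<open>y \<in> B\<close> C(2)]) (use B C S in auto)
    then show "B \<in> S" using C by simp
  qed (use S in auto)
  have blk: "S \<subseteq> J" if "partition_on J P" "S \<in> P" for S P
    using that by (rule partition_on_block_subset)
  show "inj_on Union P" if "partition_on J P" for P
    using sub[OF blk[OF that]] by (intro inj_onI) metis
  show "bij_betw (\<lambda>P. Union ` P) {P. partition_on J P} {Q. refines A J Q}"
  proof (rule bij_betw_byWitness[where f' = "\<lambda>Q. (\<lambda>C. {B \<in> J. B \<subseteq> C}) ` Q"])
    show "\<forall>P\<in>{P. partition_on J P}. (\<lambda>C. {B \<in> J. B \<subseteq> C}) ` (Union ` P) = P"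
      using sub[OF blk] by (simp add: image_image)
    show "\<forall>Q\<in>{Q. refines A J Q}. Union ` ((\<lambda>C. {B \<in> J. B \<subseteq> C}) ` Q) = Q"
    proof clarify
      fix Q assume "refines A J Q"
      then have "\<Union> {B \<in> J. B \<subseteq> C} = C" if "C \<in> Q" for C
        using partition_onD1[OF refines_obtains_subset[OF _ that]] by simp
      then show "Union ` ((\<lambda>C. {B \<in> J. B \<subseteq> C}) ` Q) = Q" by (simp add: image_image)
    qed
    show "(\<lambda>P. Union ` P) ` {P. partition_on J P} \<subseteq> {Q. refines A J Q}"
    proof (clarify)
      fix P assume P: "partition_on J P"
      have "partition_on A (Union ` P)"
      proof (rule partition_onI)
        show "\<Union> (Union ` P) = A" using P J by (auto simp: partition_on_def)
        show "{} \<notin> Union ` P"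
        proof
          assume "{} \<in> Union ` P"
          then obtain S where S: "S \<in> P" "{} = \<Union>S" by (elim imageE)
          have "C \<notin> S" for C
          proof
            assume "C \<in> S"
            then have "C = {}" "C \<in> J" using S(2) blk[OF P S(1)] by (simp_all add: subset_iff)
            then show False using partition_onD3[OF J] by simp
          qed
          then have "S = {}" by blast
          then show False using partition_onD3[OF P] S(1) by simp
        qed
        show "disjnt p q" if pq: "p \<in> Union ` P" "q \<in> Union ` P" "p \<noteq> q" for p q
        proof -
          obtain S T where ST: "S \<in> P" "T \<in> P" "p = \<Union>S" "q = \<Union>T"
            using pq(1,2) by (elim imageE)
          then have "S \<noteq> T" using pq(3) by blast
          then have "S \<inter> T = {}" using partition_onD2[OF P] ST(1,2) by (meson disjointD)
          show ?thesis unfolding ST disjnt_iff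
          proof clarify
            fix y B C assume "B \<in> S" "y \<in> B" "C \<in> T" "y \<in> C"
            then have "B = C"
              using partition_on_block_unique[OF J _ _ \<open>y \<in> B\<close> \<open>y \<in> C\<close>] blk[OF P] ST(1,2) by blast
            then show False using \<open>S \<inter> T = {}\<close> \<open>B \<in> S\<close> \<open>C \<in> T\<close> by auto
          qed
        qed
      qed
      moreover have "\<exists>Y\<in>Union ` P. B \<subseteq> Y" if "B \<in> J" for B
        using partition_on_block_exists[OF P that] by auto
      ultimately show "refines A J (Union ` P)" using J by (auto simp: refines_def)
    qed
    show "(\<lambda>Q. (\<lambda>C. {B \<in> J. B \<subseteq> C}) ` Q) ` {Q. refines A J Q} \<subseteq> {P. partition_on J P}"
    proof (clarify)
      fix Q assume Q: "refines A J Q"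
      have pQ: "partition_on A Q" using Q by (simp add: refines_def)
      show "partition_on J ((\<lambda>C. {B \<in> J. B \<subseteq> C}) ` Q)"
      proof (rule partition_onI)
        show "\<Union> ((\<lambda>C. {B \<in> J. B \<subseteq> C}) ` Q) = J" using Q by (auto simp: refines_def)
        show "{} \<notin> (\<lambda>C. {B \<in> J. B \<subseteq> C}) ` Q"
        proof
          assume "{} \<in> (\<lambda>C. {B \<in> J. B \<subseteq> C}) ` Q"
          then obtain C where C: "C \<in> Q" "{} = {B \<in> J. B \<subseteq> C}" by (elim imageE)
          have "partition_on C {}" using refines_obtains_subset[OF Q C(1)] C(2) by simp
          then show False using partition_onD3[OF pQ] C(1) by (simp add: partition_on_def)
        qed
        show "disjnt p q" if pq: "p \<in> (\<lambda>C. {B \<in> J. B \<subseteq> C}) ` Q" "q \<in> (\<lambda>C. {B \<in> J. B \<subseteq> C}) ` Q" "p \<noteq> q" for p q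
        proof -
          obtain C D where CD: "C \<in> Q" "D \<in> Q" "p = {B \<in> J. B \<subseteq> C}" "q = {B \<in> J. B \<subseteq> D}"
            using pq(1,2) by (elim imageE)
          then have "C \<noteq> D" using pq(3) by blast
          then have "C \<inter> D = {}" using partition_onD2[OF pQ] CD(1,2) by (meson disjointD)
          then show ?thesis unfolding CD(3,4) disjnt_iff using partition_onD3[OF J]
            by (metis (mono_tags, lifting) Int_greatest mem_Collect_eq subset_empty)
        qed
      qed
    qed
  qed
qed

text \<open>By distributivity the product is a sum over choices of a partition of each block of
  \<open>Q\<close>, and such a choice is the same thing as a refinement of \<open>Q\<close>.\<close>

lemma prod_sum_partitions:
  fixes K :: "'a set \<Rightarrow> real"
  assumes A: "finite A" and Q: "partition_on A Q"
  shows "(\<Prod>C\<in>Q. \<Sum>P | partition_on C P. \<Prod>B\<in>P. K B) = (\<Sum>P | refines A P Q. \<Prod>B\<in>P. K B)"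
proof -
  have finQ: "finite Q" using finite_elements[OF A Q] .
  have finC: "finite C" if "C \<in> Q" for C
    using finite_subset[OF partition_on_block_subset[OF Q that] A] .
  let ?G = "Pi\<^sub>E Q (\<lambda>C. {P. partition_on C P})"
  have G: "partition_on C (g C)" if "g \<in> ?G" "C \<in> Q" for g C
    using that by (auto simp: PiE_def Pi_def)
  have sub: "{B \<in> \<Union> (g ` Q). B \<subseteq> C} = g C" if g: "g \<in> ?G" and C: "C \<in> Q" for g C
  proof (intro equalityI subsetI)
    fix B assume "B \<in> {B \<in> \<Union> (g ` Q). B \<subseteq> C}"
    then obtain D where D: "D \<in> Q" "B \<in> g D" "B \<subseteq> C" by auto
    then obtain y where y: "y \<in> B" using partition_on_block_nonempty[OF G[OF g D(1)]] by blast
    have "y \<in> C" "y \<in> D" using y D partition_on_block_subset[OF G[OF g D(1)]] by auto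
    then have "D = C" using partition_on_block_unique[OF Q D(1) C] by blast
    then show "B \<in> g C" using D by simp
  qed (use partition_on_block_subset[OF G[OF g C]] C in auto)
  have "(\<Prod>C\<in>Q. \<Sum>P | partition_on C P. \<Prod>B\<in>P. K B) = (\<Sum>g\<in>?G. \<Prod>C\<in>Q. \<Prod>B\<in>g C. K B)"
    using finQ finC by (intro prod_sum_PiE) (auto intro: finitely_many_partition_on)
  also have "\<dots> = (\<Sum>P | refines A P Q. \<Prod>B\<in>P. K B)"
  \<comment> \<open>Glue the chosen partitions together, or cut \<open>P\<close> along the blocks of
    \<open>Q\<close>; the restriction to \<open>Q\<close> makes the cut family extensional, as
    \<open>?G\<close> demands.\<close>
  proof (rule sum.reindex_bij_witness[where j = "\<lambda>g. \<Union> (g ` Q)"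
        and i = "\<lambda>P. \<lambda>C\<in>Q. {B \<in> P. B \<subseteq> C}"])
    fix g assume g: "g \<in> ?G"
    show "(\<lambda>C\<in>Q. {B \<in> \<Union> (g ` Q). B \<subseteq> C}) = g"
      using sub[OF g] g by (intro ext) (auto simp: restrict_def PiE_def extensional_def)
    have "partition_on A (\<Union> (g ` Q))"
    proof (rule partition_onI)
      have "\<Union> (\<Union> (g ` Q)) = (\<Union>C\<in>Q. \<Union>(g C))" by auto
      also have "\<dots> = \<Union>Q" using partition_onD1[OF G[OF g]] by auto
      finally show "\<Union> (\<Union> (g ` Q)) = A" using Q by (simp add: partition_on_def)
      show "{} \<notin> \<Union> (g ` Q)" using partition_onD3[OF G[OF g]] by auto
      show "disjnt p q" if "p \<in> \<Union> (g ` Q)" "q \<in> \<Union> (g ` Q)" "p \<noteq> q" for p q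
        unfolding disjnt_iff
      proof clarify
        fix y assume y: "y \<in> p" "y \<in> q"
        obtain C D where CD: "C \<in> Q" "D \<in> Q" "p \<in> g C" "q \<in> g D" using \<open>p \<in> _\<close> \<open>q \<in> _\<close> by auto
        then have "y \<in> C" "y \<in> D" using y partition_on_block_subset[OF G[OF g]] by blast+
        then have "C = D" using partition_on_block_unique[OF Q] CD by blast
        then show False using partition_on_block_unique[OF G[OF g CD(1)]] CD y \<open>p \<noteq> q\<close> by blast
      qed
    qed
    then show "\<Union> (g ` Q) \<in> {P. refines A P Q}"
      using Q partition_on_block_subset[OF G[OF g]] by (auto simp: refines_def)
    show "(\<Prod>B\<in>\<Union> (g ` Q). K B) = (\<Prod>C\<in>Q. \<Prod>B\<in>g C. K B)"
    proof (rule prod.UNION_disjoint[OF finQ])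
      show "\<forall>C\<in>Q. finite (g C)" using finite_elements[OF finC G[OF g]] by auto
      show "\<forall>C\<in>Q. \<forall>D\<in>Q. C \<noteq> D \<longrightarrow> g C \<inter> g D = {}"
      proof (intro ballI impI, rule ccontr)
        fix C D assume CD: "C \<in> Q" "D \<in> Q" "C \<noteq> D" "g C \<inter> g D \<noteq> {}"
        then obtain B where B: "B \<in> g C" "B \<in> g D" by auto
        then obtain y where "y \<in> B" using partition_on_block_nonempty[OF G[OF g CD(1)]] CD by blast
        then have "y \<in> C" "y \<in> D" using B partition_on_block_subset[OF G[OF g]] CD by blast+
        then show False using partition_on_block_unique[OF Q] CD by blast
      qed
    qed
  next
    fix P assume "P \<in> {P. refines A P Q}"
    then have P: "refines A P Q" by simp
    show "\<Union> ((\<lambda>C\<in>Q. {B \<in> P. B \<subseteq> C}) ` Q) = P" using P by (auto simp: refines_def)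
    show "(\<lambda>C\<in>Q. {B \<in> P. B \<subseteq> C}) \<in> ?G" using refines_obtains_subset[OF P] by auto
  qed
  finally show ?thesis .
qed

section \<open>Joins and complementary partitions\<close>

text \<open>For a partition of \<open>{..<p}\<close> these functions, read on \<open>{..<p}\<close>,
  form the column span of its indicator matrix.\<close>

definition constant_on_blocks :: "'a set set \<Rightarrow> ('a \<Rightarrow> real) \<Rightarrow> bool" where
  "constant_on_blocks P f \<longleftrightarrow> (\<forall>B\<in>P. \<forall>x\<in>B. \<forall>y\<in>B. f x = f y)"

text \<open>The span condition of \<open>complementary\<close> for real functions: whatever lies in
  both spans is constant on \<open>A\<close>. The join enters only afterwards, through
  \<open>partition_join\<close>.\<close>

definition complementary_partitions :: "'a set \<Rightarrow> 'a set set \<Rightarrow> 'a set set \<Rightarrow> bool" where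
  "complementary_partitions A P Q \<longleftrightarrow>
     (\<forall>f. constant_on_blocks P f \<and> constant_on_blocks Q f \<longrightarrow> (\<forall>x\<in>A. \<forall>y\<in>A. f x = f y))"

text \<open>
  The join is the quotient by the relation "every real function that is constant on the blocks
  of both partitions agrees at \<open>x\<close> and \<open>y\<close>"; it has at most one block exactly when only
  constant functions qualify, i.e. when the column spans meet in the line of constants.
\<close>

lemma partition_join:
  assumes P: "partition_on A P" and Q: "partition_on A Q" and A: "finite A"
  obtains J where "partition_on A J" "\<And>S. refines A P S \<and> refines A Q S \<longleftrightarrow> refines A J S"
    "card J \<le> 1 \<longleftrightarrow> complementary_partitions A P Q"
proof
  define R where "R = {(x, y). x \<in> A \<and> y \<in> A \<and>
    (\<forall>f. constant_on_blocks P f \<and> constant_on_blocks Q f \<longrightarrow> f x = f y)}"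
  have R: "equiv A R" by (rule equivI) (auto simp: R_def refl_on_def sym_def trans_def)
  show J: "partition_on A (A // R)" using partition_on_quotient[OF R] .
  have up: "\<exists>Y\<in>A // R. B \<subseteq> Y" if "B \<in> P \<or> B \<in> Q" for B
  proof -
    have ne: "B \<noteq> {}" and sub: "B \<subseteq> A" using that P Q by (auto simp: partition_on_def)
    then obtain x where x: "x \<in> B" by auto
    have "B \<subseteq> R `` {x}"
    proof
      fix y assume y: "y \<in> B"
      then have "f x = f y" if "constant_on_blocks P f \<and> constant_on_blocks Q f" for f
        using that \<open>B \<in> P \<or> B \<in> Q\<close> x unfolding constant_on_blocks_def by blast
      then show "y \<in> R `` {x}" using x y sub by (simp add: R_def subset_iff)
    qed
    then show ?thesis using x sub by (auto intro: quotientI)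
  qed
  then have PJ: "refines A P (A // R)" "refines A Q (A // R)" using P Q J by (auto simp: refines_def)
  show "refines A P S \<and> refines A Q S \<longleftrightarrow> refines A (A // R) S" for S
  proof
    assume S: "refines A P S \<and> refines A Q S"
    then have pS: "partition_on A S" by (simp add: refines_def)
    have "\<exists>Y\<in>S. C \<subseteq> Y" if C: "C \<in> A // R" for C
    proof -
      obtain x where x: "x \<in> A" "C = R `` {x}" using C by (auto elim: quotientE)
      obtain Y where Y: "Y \<in> S" "x \<in> Y" using partition_on_block_exists[OF pS x(1)] by auto
      \<comment> \<open>The indicator function of a block \<open>Y\<close> of \<open>S\<close> is
        constant on the blocks of everything finer than \<open>S\<close>, so a point related to
        \<open>x\<close> by \<open>R\<close> cannot leave the block of \<open>x\<close>.\<close>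
      have const: "constant_on_blocks T (\<lambda>z. if z \<in> Y then 1 else 0)" if TS: "refines A T S" for T
        unfolding constant_on_blocks_def
      proof (intro ballI)
        fix B a b assume B: "B \<in> T" "a \<in> B" "b \<in> B"
        then obtain Z where Z: "Z \<in> S" "B \<subseteq> Z" using TS unfolding refines_def by blast
        have "c \<in> Y \<longleftrightarrow> Z = Y" if "c \<in> B" for c
          using partition_on_block_unique[OF pS Z(1) Y(1)] that Z(2) by blast
        then have "a \<in> Y \<longleftrightarrow> Z = Y" "b \<in> Y \<longleftrightarrow> Z = Y" using B by blast+
        then show "(if a \<in> Y then 1 else 0) = (if b \<in> Y then 1 else (0::real))" by simp
      qed
      have "y \<in> Y" if y: "(x, y) \<in> R" for y
      proof -
        let ?f = "\<lambda>z. if z \<in> Y then 1 else 0 :: real"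
        have "constant_on_blocks P ?f" "constant_on_blocks Q ?f"
          using const S by auto
        then have "?f x = ?f y" using y unfolding R_def by blast
        then show ?thesis using Y by (simp split: if_splits)
      qed
      then show ?thesis using x Y by auto
    qed
    then show "refines A (A // R) S" using J pS by (auto simp: refines_def)
  qed (use PJ refines_trans in blast)
  have fJ: "finite (A // R)" using finite_elements[OF A J] .
  have "complementary_partitions A P Q \<longleftrightarrow> (\<forall>x\<in>A. \<forall>y\<in>A. (x, y) \<in> R)"
    unfolding complementary_partitions_def R_def by blast
  also have "\<dots> \<longleftrightarrow> (\<forall>C\<in>A // R. \<forall>D\<in>A // R. C = D)"
    by (auto simp: quotient_def eq_equiv_class_iff[OF R])
  also have "\<dots> \<longleftrightarrow> card (A // R) \<le> 1"
    using card_le_Suc0_iff_eq[OF fJ] by auto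
  finally show "card (A // R) \<le> 1 \<longleftrightarrow> complementary_partitions A P Q" by simp
qed

section \<open>Moebius inversion above a fixed partition\<close>

text \<open>Carries the sum along \<open>bij_betw_coarsenings\<close>. It serves with constant
  \<open>m\<close> for the inner sum of the inversion and with a general \<open>m\<close> for the
  cumulant of block products.\<close>

lemma sum_moebius_coeff_coarsenings:
  assumes J: "partition_on A J"
  shows "(\<Sum>P | partition_on J P. moebius_coeff (card P) * (\<Prod>S\<in>P. m (\<Union>S))) =
    (\<Sum>Q | refines A J Q. moebius_coeff (card Q) * (\<Prod>C\<in>Q. m C))"
proof -
  have "(\<Sum>P | partition_on J P. moebius_coeff (card P) * (\<Prod>S\<in>P. m (\<Union>S))) =
    (\<Sum>P | partition_on J P. moebius_coeff (card (Union ` P)) * (\<Prod>C\<in>Union ` P. m C))"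
    using bij_betw_coarsenings(2)[OF J]
    by (intro sum.cong) (auto simp: card_image prod.reindex)
  also have "\<dots> = (\<Sum>Q | refines A J Q. moebius_coeff (card Q) * (\<Prod>C\<in>Q. m C))"
    by (rule sum.reindex_bij_betw[OF bij_betw_coarsenings(1)[OF J]])
  finally show ?thesis .
qed

text \<open>After expanding the moments and exchanging the sums, the coefficient of \<open>T\<close>
  is the sum of \<open>moebius_coeff\<close> over the common coarsenings of \<open>P\<close> and
  \<open>T\<close>: 1 if their join has at most one block, and 0 otherwise. The function
  \<open>K\<close> is left open because the inversion also serves to identify it with the
  cumulant.\<close>

lemma sum_moebius_coeff_refines:
  fixes m K :: "'a set \<Rightarrow> real"
  assumes A: "finite A" and P: "partition_on A P"
    and m: "\<And>C. C \<subseteq> A \<Longrightarrow> C \<noteq> {} \<Longrightarrow> m C = (\<Sum>T | partition_on C T. \<Prod>B\<in>T. K B)"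
  shows "(\<Sum>Q | refines A P Q. moebius_coeff (card Q) * (\<Prod>C\<in>Q. m C)) =
    (\<Sum>T | partition_on A T \<and> complementary_partitions A P T. \<Prod>B\<in>T. K B)"
proof -
  have fin: "finite {T. partition_on A T}" using finitely_many_partition_on[OF A] .
  have finr: "finite {Q. refines A P Q}" by (rule finite_subset[OF _ fin]) (auto simp: refines_def)
  have inner: "(\<Sum>Q | refines A P Q \<and> refines A T Q. moebius_coeff (card Q)) =
      (if complementary_partitions A P T then 1 else 0)" if T: "partition_on A T" for T
  proof -
    obtain J where J: "partition_on A J" "\<And>S. refines A P S \<and> refines A T S \<longleftrightarrow> refines A J S"
      "card J \<le> 1 \<longleftrightarrow> complementary_partitions A P T"
      using partition_join[OF P T A] by blast
    have "(\<Sum>Q | refines A P Q \<and> refines A T Q. moebius_coeff (card Q)) =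
        (\<Sum>Q | partition_on J Q. moebius_coeff (card Q))"
      using sum_moebius_coeff_coarsenings[OF J(1), of "\<lambda>_. 1"] by (simp add: J(2))
    also have "\<dots> = (if card J \<le> 1 then 1 else 0)"
      by (rule sum_moebius_coeff_partitions) (rule finite_elements[OF A J(1)])
    finally show ?thesis using J(3) by presburger
  qed
  have mQ: "(\<Prod>C\<in>Q. m C) = (\<Sum>T | refines A T Q. \<Prod>B\<in>T. K B)" if "refines A P Q" for Q
  proof -
    have Q: "partition_on A Q" using that by (simp add: refines_def)
    have "(\<Prod>C\<in>Q. m C) = (\<Prod>C\<in>Q. \<Sum>T | partition_on C T. \<Prod>B\<in>T. K B)"
      using Q by (intro prod.cong refl m) (auto simp: partition_on_def)
    then show ?thesis using prod_sum_partitions[OF A Q] by simp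
  qed
  have "(\<Sum>Q | refines A P Q. moebius_coeff (card Q) * (\<Prod>C\<in>Q. m C)) =
      (\<Sum>Q | refines A P Q. \<Sum>T | T \<in> {T. partition_on A T} \<and> refines A T Q.
        moebius_coeff (card Q) * (\<Prod>B\<in>T. K B))"
    by (intro sum.cong) (auto simp: mQ sum_distrib_left refines_def intro!: sum.cong)
  also have "\<dots> = (\<Sum>T | partition_on A T. \<Sum>Q | Q \<in> {Q. refines A P Q} \<and> refines A T Q.
        moebius_coeff (card Q) * (\<Prod>B\<in>T. K B))"
    using sum.swap_restrict[OF finr fin] by simp
  also have "\<dots> = (\<Sum>T | partition_on A T. if complementary_partitions A P T then \<Prod>B\<in>T. K B else 0)"
    by (intro sum.cong) (auto simp: inner sum_distrib_right[symmetric])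
  also have "\<dots> = (\<Sum>T | partition_on A T \<and> complementary_partitions A P T. \<Prod>B\<in>T. K B)"
    using sum.inter_filter[OF fin, of "\<lambda>T. \<Prod>B\<in>T. K B" "complementary_partitions A P"] by simp
  finally show ?thesis .
qed

subsection \<open>The Leonov--Shiryaev formula\<close>

text \<open>\<open>m\<close> plays the role of the moments, as a function of the set of factors.
  Keeping it abstract lets one formula serve for positions in a list, for elements of a block, and
  for the set of blocks with \<open>m (\<Union>S)\<close>.\<close>

definition set_cumulant :: "('a set \<Rightarrow> real) \<Rightarrow> 'a set \<Rightarrow> real" where
  "set_cumulant m A = (\<Sum>P | partition_on A P. moebius_coeff (card P) * (\<Prod>B\<in>P. m B))"

lemma moment_eq_sum_cumulants:
  assumes "finite A" "A \<noteq> {}"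
  shows "m A = (\<Sum>P | partition_on A P. \<Prod>B\<in>P. set_cumulant m B)"
  using assms
proof (induction A rule: finite_psubset_induct)
  case (psubset A)
  let ?D = "(\<lambda>x. {x}) ` A" and ?N = "{P. partition_on A P} - {{A}}"
  \<comment> \<open>The value at \<open>A\<close> is chosen to make the identity true for \<open>A\<close>; Moebius inversion then
    shows that it is the cumulant.\<close>
  define K where "K B = (if B = A then m A - (\<Sum>P\<in>?N. \<Prod>B\<in>P. set_cumulant m B)
      else set_cumulant m B)" for B
  have fin: "finite {P. partition_on A P}" 
    by (rule finitely_many_partition_on[OF psubset.hyps])
  have one: "{A} \<in> {P. partition_on A P}" using partition_on_space[OF psubset.prems] by simp
  have split: "(\<Sum>P | partition_on A P. \<Prod>B\<in>P. F B) = F A + (\<Sum>P\<in>?N. \<Prod>B\<in>P. F B)"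
    for F :: "'a set \<Rightarrow> real"
    by (subst sum.remove[OF fin one]) simp
  \<comment> \<open>A partition other than \<open>{A}\<close> has only proper subsets of
    \<open>A\<close> as blocks, and there \<open>K\<close> is the cumulant by definition.\<close>
  have notA: "B \<noteq> A" if "P \<in> ?N" "B \<in> P" for P B
  proof
    assume "B = A"
    have P: "partition_on A P" using that by simp
    have "C = A" if C: "C \<in> P" for C
    proof -
      obtain y where y: "y \<in> C" using partition_on_block_nonempty[OF P C] by blast
      then have "y \<in> A" using partition_on_block_subset[OF P C] by blast
      then show ?thesis
        using partition_on_block_unique[OF P C _ y] \<open>B \<in> P\<close> \<open>B = A\<close> by blast
    qed
    moreover have "P \<noteq> {A}" "P \<noteq> {}" using that by auto
    ultimately show False by blast
  qed
  have N: "(\<Sum>P\<in>?N. \<Prod>B\<in>P. K B) = (\<Sum>P\<in>?N. \<Prod>B\<in>P. set_cumulant m B)"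
    using notA by (intro sum.cong prod.cong) (auto simp: K_def)
  have K: "m C = (\<Sum>T | partition_on C T. \<Prod>B\<in>T. K B)" if C: "C \<subseteq> A" "C \<noteq> {}" for C
  proof (cases "C = A")
    case True
    show ?thesis unfolding True split N by (simp add: K_def)
  next
    case False
    then have "m C = (\<Sum>T | partition_on C T. \<Prod>B\<in>T. set_cumulant m B)"
      using psubset.IH C by blast
    also have "\<dots> = (\<Sum>T | partition_on C T. \<Prod>B\<in>T. K B)"
    proof (intro sum.cong prod.cong refl)
      fix T B assume "T \<in> {T. partition_on C T}" "B \<in> T"
      then have "B \<subseteq> C" using partition_on_block_subset by blast
      then show "set_cumulant m B = K B" using False C by (auto simp: K_def)
    qed
    finally show ?thesis .
  qed
  \<comment> \<open>The inversion is applied to the partition into singletons: every partition of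
    \<open>A\<close> coarsens it and only \<open>{A}\<close> is complementary to it, so the single
    term \<open>K A\<close> remains.\<close>
  have D: "partition_on A ?D" by (rule partition_on_singletons)
  have ref: "refines A ?D Q \<longleftrightarrow> partition_on A Q" for Q
    using D partition_on_block_exists[of A Q] by (auto simp: refines_def)
  have conn: "partition_on A T \<and> complementary_partitions A ?D T \<longleftrightarrow> T = {A}" for T
  proof
    assume T: "partition_on A T \<and> complementary_partitions A ?D T"
    then have pT: "partition_on A T" by simp
    have "C = A" if C: "C \<in> T" for C
    proof -
      obtain x where x: "x \<in> C" using partition_on_block_nonempty[OF pT C] by blast
      let ?f = "\<lambda>z. if z \<in> C then 1 else 0 :: real"
      have "constant_on_blocks T ?f" "constant_on_blocks ?D ?f"
        using partition_on_block_unique[OF pT _ C] by (auto simp: constant_on_blocks_def)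
      then have "?f x = ?f y" if "y \<in> A" for y
        using T that x partition_on_block_subset[OF pT C]
        unfolding complementary_partitions_def by blast
      then have "y \<in> C" if "y \<in> A" for y using that x by (metis zero_neq_one)
      then have "A \<subseteq> C" by blast
      then show "C = A" using partition_on_block_subset[OF pT C] by blast
    qed
    moreover have "T \<noteq> {}" using pT psubset.prems by (auto simp: partition_on_def)
    ultimately show "T = {A}" by blast
  next
    assume T: "T = {A}"
    have "\<forall>x\<in>A. \<forall>y\<in>A. f x = f y" if "constant_on_blocks {A} f" for f
      using that unfolding constant_on_blocks_def by blast
    then show "partition_on A T \<and> complementary_partitions A ?D T"
      using partition_on_space[OF psubset.prems] unfolding T complementary_partitions_def by blast
  qed
  have "set_cumulant m A = K A"
    using sum_moebius_coeff_refines[OF \<open>finite A\<close> D K]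
    unfolding set_cumulant_def ref conn by simp
  then show ?case unfolding split by (simp add: K_def)
qed

text \<open>A partition of the set \<open>P\<close> amounts to a coarsening, so the left side
  becomes the sum treated by \<open>sum_moebius_coeff_refines\<close>, with the cumulants of
  \<open>m\<close> as \<open>K\<close>. The identity is purely combinatorial: \<open>m\<close> is an
  arbitrary real function of sets.\<close>

theorem leonov_shiryaev:
  assumes A: "finite A" and P: "partition_on A P"
  shows "set_cumulant (\<lambda>S. m (\<Union>S)) P =
    (\<Sum>Q | partition_on A Q \<and> complementary_partitions A P Q. \<Prod>B\<in>Q. set_cumulant m B)"
  unfolding set_cumulant_def[of _ P] sum_moebius_coeff_coarsenings[OF P]
proof (rule sum_moebius_coeff_refines[OF A P])
  show "m C = (\<Sum>T | partition_on C T. \<Prod>B\<in>T. set_cumulant m B)" if "C \<subseteq> A" "C \<noteq> {}" for C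
    using moment_eq_sum_cumulants[OF finite_subset[OF that(1) A] that(2)] .
qed

section \<open>Invariance of cumulants under relabelling\<close>

lemma set_cumulant_cong:
  assumes "\<And>B. B \<subseteq> A \<Longrightarrow> m B = m' B"
  shows "set_cumulant m A = set_cumulant m' A"
  unfolding set_cumulant_def
proof (intro sum.cong refl arg_cong2[where f = "(*)"] prod.cong)
  fix P B assume "P \<in> {P. partition_on A P}" "B \<in> P"
  then show "m B = m' B" using assms partition_on_block_subset[of A P B] by simp
qed

lemma partition_on_image:
  assumes "partition_on I P" "inj_on f I"
  shows "partition_on (f ` I) ((`) f ` P)"
proof -
  have "{} \<notin> (`) f ` P" using partition_onD3[OF assms(1)] by auto
  then show ?thesis using partition_on_inj_image[OF assms] by simp
qed

text \<open>An injection carries the partitions of \<open>I\<close> bijectively to those of its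
  image, with the same number of blocks.\<close>

lemma set_cumulant_image:
  assumes f: "inj_on f I"
  shows "set_cumulant m (f ` I) = set_cumulant (\<lambda>B. m (f ` B)) I"
proof -
  let ?F = "\<lambda>P. (`) f ` P"
  have img: "(`) (inv_into I f) ` ?F P = P" if "partition_on I P" for P
  proof -
    have "inv_into I f ` f ` B = B" if "B \<in> P" for B
      using inv_into_image_cancel[OF f partition_on_block_subset[OF \<open>partition_on I P\<close> that]] .
    then show ?thesis by (simp add: image_image)
  qed
  have img': "?F ((`) (inv_into I f) ` P) = P" if "partition_on (f ` I) P" for P
  proof -
    have "f ` inv_into I f ` B = B" if "B \<in> P" for B
      using image_inv_into_cancel[OF refl partition_on_block_subset[OF \<open>partition_on (f ` I) P\<close> that]] .
    then show ?thesis by (simp add: image_image)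
  qed
  have inj: "inj_on ((`) f) P" if "partition_on I P" for P
    using inj_on_image_eq_iff[OF f] partition_on_block_subset[OF that] by (intro inj_onI) blast
  have "bij_betw ?F {P. partition_on I P} {P. partition_on (f ` I) P}"
  proof (rule bij_betw_byWitness[where f' = "\<lambda>P. (`) (inv_into I f) ` P"])
    show "?F ` {P. partition_on I P} \<subseteq> {P. partition_on (f ` I) P}" 
      using partition_on_image[OF _ f] by auto
    show "(\<lambda>P. (`) (inv_into I f) ` P) ` {P. partition_on (f ` I) P} \<subseteq> {P. partition_on I P}"
      using partition_on_image[of "f ` I" _ "inv_into I f"] f by (auto simp: inj_on_inv_into)
  qed (use img img' in auto)
  from sum.reindex_bij_betw[OF this, of "\<lambda>P. moebius_coeff (card P) * prod m P"]
  have "set_cumulant m (f ` I) =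
      (\<Sum>P | partition_on I P. moebius_coeff (card (?F P)) * prod m (?F P))"
    unfolding set_cumulant_def by simp
  also have "\<dots> = set_cumulant (\<lambda>B. m (f ` B)) I"
    unfolding set_cumulant_def using inj by (intro sum.cong) (auto simp: card_image prod.reindex)
  finally show ?thesis .
qed

subsection \<open>Cumulants of labelled lists\<close>

lemma joint_cumulant_bij:
  assumes h: "bij_betw h {..<length Z} B" and Z: "\<And>j. j < length Z \<Longrightarrow> Z ! j = f (h j)"
  shows "joint_cumulant M Z = set_cumulant (\<lambda>C. integral\<^sup>L M (\<lambda>\<omega>. \<Prod>t\<in>C. f t \<omega>)) B"
proof -
  have inj: "inj_on h {..<length Z}" and B: "B = h ` {..<length Z}"
    using h by (auto simp: bij_betw_def)
  have "joint_cumulant M Z =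
      set_cumulant (\<lambda>C. integral\<^sup>L M (\<lambda>\<omega>. \<Prod>j\<in>C. (Z ! j) \<omega>)) {..<length Z}"
    by (simp add: joint_cumulant_def set_cumulant_def moebius_coeff_def)
  also have "\<dots> = set_cumulant (\<lambda>C. integral\<^sup>L M (\<lambda>\<omega>. \<Prod>t\<in>h ` C. f t \<omega>)) {..<length Z}"
  proof (rule set_cumulant_cong)
    fix C assume C: "C \<subseteq> {..<length Z}"
    have "(\<Prod>j\<in>C. (Z ! j) \<omega>) = (\<Prod>t\<in>h ` C. f t \<omega>)" for \<omega>
      using Z C by (subst prod.reindex[OF inj_on_subset[OF inj C]]) (auto intro!: prod.cong)
    then show "integral\<^sup>L M (\<lambda>\<omega>. \<Prod>j\<in>C. (Z ! j) \<omega>) = integral\<^sup>L M (\<lambda>\<omega>. \<Prod>t\<in>h ` C. f t \<omega>)"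
      by simp
  qed
  also have "\<dots> = set_cumulant (\<lambda>C. integral\<^sup>L M (\<lambda>\<omega>. \<Prod>t\<in>C. f t \<omega>)) B"
    unfolding B by (rule set_cumulant_image[OF inj, symmetric])
  finally show ?thesis .
qed

text \<open>Lists with equal multisets differ by a bijection of positions. This bridges the list
  grouped by variable in \<open>multivariate_cumulant\<close> and the variables labelled along a
  block.\<close>

lemma joint_cumulant_mset_set:
  assumes B: "finite B" and Z: "mset Z = image_mset f (mset_set B)"
  shows "joint_cumulant M Z = set_cumulant (\<lambda>C. integral\<^sup>L M (\<lambda>\<omega>. \<Prod>t\<in>C. f t \<omega>)) B"
proof -
  obtain ys where ys: "set ys = B" "distinct ys" using finite_distinct_list[OF B] by blast
  then have "mset Z = mset (map f ys)" using Z by (simp add: mset_set_set[symmetric])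
  from permutation_Ex_bij[OF this] obtain g where
    g: "bij_betw g {..<length Z} {..<length ys}" "\<And>j. j < length Z \<Longrightarrow> Z ! j = map f ys ! g j"
    by auto
  have "bij_betw ((!) ys \<circ> g) {..<length Z} B"
    using g(1) bij_betw_nth[OF ys(2) refl ys(1)[symmetric]] by (rule bij_betw_trans)
  moreover have "Z ! j = f (((!) ys \<circ> g) j)" if "j < length Z" for j
    using g that bij_betwE[OF g(1)] by auto
  ultimately show ?thesis by (rule joint_cumulant_bij)
qed

section \<open>Multi-indices of blocks\<close>

text \<open>The column that the reverse transformation under \<open>\<sigma>\<close> makes of the
  block \<open>B\<close>.\<close>

definition block_index :: "nat \<Rightarrow> nat list \<Rightarrow> nat set \<Rightarrow> multi_index" where
  "block_index n \<sigma> B = map (\<lambda>k. card {t \<in> B. \<sigma> ! t = k}) [0..<n]"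

lemma length_block_index [simp]: "length (block_index n \<sigma> B) = n"
  by (simp add: block_index_def)

lemma nth_block_index [simp]: "k < n \<Longrightarrow> block_index n \<sigma> B ! k = card {t \<in> B. \<sigma> ! t = k}"
  by (simp add: block_index_def)

lemma count_concat_replicate:
  "count (mset (concat (map (\<lambda>k. replicate (c k) k) [0..<n]))) x = (if x < n then c x else 0)"
  by (induction n) auto

lemma multivariate_cumulant_block_index:
  assumes B: "finite B" and \<sigma>: "\<And>t. t \<in> B \<Longrightarrow> \<sigma> ! t < n"
  shows "multivariate_cumulant M X (block_index n \<sigma> B) =
    set_cumulant (\<lambda>C. integral\<^sup>L M (\<lambda>\<omega>. \<Prod>t\<in>C. X (\<sigma> ! t) \<omega>)) B"
  unfolding multivariate_cumulant_def
proof (rule joint_cumulant_mset_set[OF B])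
  let ?L = "concat (map (\<lambda>k. replicate (block_index n \<sigma> B ! k) k) [0..<n])"
  \<comment> \<open>The multisets are compared at the level of labels, where occurrences can be
    counted, and \<open>X\<close> is applied afterwards; different labels may carry the same
    variable.\<close>
  have "mset ?L = image_mset ((!) \<sigma>) (mset_set B)"
  proof (rule multiset_eqI)
    fix k
    have "count (image_mset ((!) \<sigma>) (mset_set B)) k = card {t \<in> B. \<sigma> ! t = k}"
    proof -
      have "((!) \<sigma>) -` {k} \<inter> B = {t \<in> B. \<sigma> ! t = k}" by auto
      then have "count (image_mset ((!) \<sigma>) (mset_set B)) k =
          (\<Sum>t | t \<in> B \<and> \<sigma> ! t = k. count (mset_set B) t)"
        using B by (simp add: count_image_mset)
      also have "\<dots> = (\<Sum>t | t \<in> B \<and> \<sigma> ! t = k. 1)"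
        using B by (intro sum.cong) auto
      finally show ?thesis by simp
    qed
    moreover have "{t \<in> B. \<sigma> ! t = k} = {}" if "\<not> k < n" using \<sigma> that by auto
    ultimately show "count (mset ?L) k = count (image_mset ((!) \<sigma>) (mset_set B)) k"
      unfolding count_concat_replicate by (auto simp del: Collect_empty_eq)
  qed
  then have "mset (map X ?L) = image_mset (\<lambda>t. X (\<sigma> ! t)) (mset_set B)"
    by (simp add: image_mset.compositionality comp_def)
  then show "mset (concat (map (\<lambda>k. replicate (block_index n \<sigma> B ! k) (X k))
      [0..<length (block_index n \<sigma> B)])) = image_mset (\<lambda>t. X (\<sigma> ! t)) (mset_set B)"
    by (simp only: map_concat map_map comp_def map_replicate length_block_index)
qed

lemma mpower_block_index:
  assumes B: "finite B" and \<sigma>: "\<And>t. t \<in> B \<Longrightarrow> \<sigma> ! t < n"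
  shows "mpower X (block_index n \<sigma> B) \<omega> = (\<Prod>t\<in>B. X (\<sigma> ! t) \<omega>)"
proof -
  have "(\<Prod>t\<in>B. X (\<sigma> ! t) \<omega>) = (\<Prod>k<n. \<Prod>t | t \<in> B \<and> \<sigma> ! t = k. X (\<sigma> ! t) \<omega>)"
    using \<sigma> by (intro prod.group[symmetric] B) auto
  also have "\<dots> = mpower X (block_index n \<sigma> B) \<omega>" by (simp add: mpower_def)
  finally show ?thesis by simp
qed

subsection \<open>Column spans and complements\<close>

definition indicator_column :: "nat \<Rightarrow> nat set \<Rightarrow> nat list" where
  "indicator_column p B = map (\<lambda>t. if t \<in> B then 1 else 0) [0..<p]"

lemma nth_indicator_column [simp]:
  "t < p \<Longrightarrow> indicator_column p B ! t = (if t \<in> B then 1 else 0)"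
  by (simp add: indicator_column_def)

text \<open>Every position lies in exactly one block, so a linear combination of the columns takes
  at \<open>t\<close> the coefficient of the block of \<open>t\<close>.\<close>

lemma column_span_indicator:
  assumes Bs: "distinct Bs" "partition_on {..<p} (set Bs)"
  shows "v \<in> column_span p (map (indicator_column p) Bs) \<longleftrightarrow>
    length v = p \<and> constant_on_blocks (set Bs) (\<lambda>t. v ! t)"
proof -
  have lt: "t < p" if "t \<in> B" "B \<in> set Bs" for t B
    using partition_on_block_subset[OF Bs(2) that(2)] that(1) by auto
  have sum: "(\<Sum>q<length Bs. c q * real (map (indicator_column p) Bs ! q ! t)) = c q0"
    if t: "t \<in> Bs ! q0" "q0 < length Bs" for t q0 and c :: "nat \<Rightarrow> real"
  proof -
    have "t \<in> Bs ! q \<longleftrightarrow> q = q0" if "q < length Bs" for q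
      using partition_on_block_unique[OF Bs(2) _ _ _ t(1), of "Bs ! q"] that t
        nth_eq_iff_index_eq[OF Bs(1) that t(2)] by auto
    then have "(\<Sum>q<length Bs. c q * real (map (indicator_column p) Bs ! q ! t)) =
        (\<Sum>q<length Bs. if q = q0 then c q else 0)"
      using lt[OF t(1) nth_mem[OF t(2)]] by (intro sum.cong) auto
    then show ?thesis using t(2) by simp
  qed
  show ?thesis
  proof
    assume v: "v \<in> column_span p (map (indicator_column p) Bs)"
    then obtain c where len: "length v = p" and
      c: "\<And>t. t < p \<Longrightarrow> v ! t = (\<Sum>q<length Bs. c q * real (map (indicator_column p) Bs ! q ! t))"
      by (auto simp: column_span_def)
    have "v ! x = v ! y" if B: "B \<in> set Bs" "x \<in> B" "y \<in> B" for B x y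
    proof -
      obtain q0 where q0: "q0 < length Bs" "B = Bs ! q0" using B(1) by (auto simp: in_set_conv_nth)
      then have "v ! z = c q0" if "z \<in> B" for z
        using c[OF lt[OF that B(1)]] sum[of z q0 c] that by simp
      then show ?thesis using B by simp
    qed
    then show "length v = p \<and> constant_on_blocks (set Bs) (\<lambda>t. v ! t)"
      using len unfolding constant_on_blocks_def by blast
  next
    assume v: "length v = p \<and> constant_on_blocks (set Bs) (\<lambda>t. v ! t)"
    \<comment> \<open>The coefficient of a block is the value of \<open>v\<close> at any of its
      points; the choice is sound because blocks are nonempty.\<close>
    define c where "c q = v ! (SOME t. t \<in> Bs ! q)" for q
    have "v ! t = (\<Sum>q<length Bs. c q * real (map (indicator_column p) Bs ! q ! t))" if tp: "t < p" for t
    proof -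
      obtain q0 where q0: "q0 < length Bs" "t \<in> Bs ! q0"
        using partition_on_block_exists[OF Bs(2), of t] tp by (auto simp: in_set_conv_nth Bex_def)
      then have "(SOME s. s \<in> Bs ! q0) \<in> Bs ! q0" by (intro someI)
      then have "c q0 = v ! t"
        using v q0 nth_mem[OF q0(1)] unfolding constant_on_blocks_def c_def by blast
      then show ?thesis using sum[OF q0(2,1)] by simp
    qed
    then show "v \<in> column_span p (map (indicator_column p) Bs)"
      using v unfolding column_span_def by auto
  qed
qed

text \<open>Constant vectors lie in both spans, so one inclusion decides. What remains is the
  passage between vectors of length \<open>p\<close> and functions, which matter only through their
  values below \<open>p\<close>.\<close>

lemma complementary_indicator:
  assumes "distinct Bs" "partition_on {..<p} (set Bs)" "distinct Cs" "partition_on {..<p} (set Cs)"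
  shows "complementary p (map (indicator_column p) Bs) (map (indicator_column p) Cs) \<longleftrightarrow>
    complementary_partitions {..<p} (set Bs) (set Cs)"
proof -
  have lt: "t < p" if "t \<in> B" "B \<in> set Bs \<or> B \<in> set Cs" for t B
    using partition_on_block_subset[OF assms(2), of B] partition_on_block_subset[OF assms(4), of B]
      that by auto
  have rep: "constant_on_blocks (set Bs) (\<lambda>t. replicate p c ! t)"
     "constant_on_blocks (set Cs) (\<lambda>t. replicate p c ! t)" for c
    using lt by (auto simp: constant_on_blocks_def)
  let ?V = "column_span p (map (indicator_column p) Bs) \<inter> column_span p (map (indicator_column p) Cs)"
  have V: "v \<in> ?V \<longleftrightarrow> length v = p \<and> constant_on_blocks (set Bs) (\<lambda>t. v ! t) \<and>
      constant_on_blocks (set Cs) (\<lambda>t. v ! t)" for v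
    using column_span_indicator[OF assms(1,2)] column_span_indicator[OF assms(3,4)] by blast
  have "replicate p c \<in> ?V" for c unfolding V using rep by simp
  then have "{replicate p c | c. True} \<subseteq> ?V" by blast
  then have "complementary p (map (indicator_column p) Bs) (map (indicator_column p) Cs) \<longleftrightarrow>
      ?V \<subseteq> {replicate p c | c. True}"
    unfolding complementary_def by (metis order_refl subset_antisym)
  also have "\<dots> \<longleftrightarrow> (\<forall>v\<in>?V. \<exists>c. v = replicate p c)" by blast
  also have "\<dots> \<longleftrightarrow> complementary_partitions {..<p} (set Bs) (set Cs)"
  proof
    assume L: "\<forall>v\<in>?V. \<exists>c. v = replicate p c"
    show "complementary_partitions {..<p} (set Bs) (set Cs)"
      unfolding complementary_partitions_def
    proof (intro allI impI ballI)
      fix f :: "nat \<Rightarrow> real" and x y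
      assume f: "constant_on_blocks (set Bs) f \<and> constant_on_blocks (set Cs) f"
        and xy: "x \<in> {..<p}" "y \<in> {..<p}"
      have "constant_on_blocks (set Bs) (\<lambda>t. map f [0..<p] ! t)"
        "constant_on_blocks (set Cs) (\<lambda>t. map f [0..<p] ! t)"
      proof -
        have "map f [0..<p] ! a = map f [0..<p] ! b" if "B \<in> set Bs \<or> B \<in> set Cs" "a \<in> B" "b \<in> B"
          for B a b
        proof -
          have "f a = f b" using f that unfolding constant_on_blocks_def by blast
          then show ?thesis using lt[OF that(2,1)] lt[OF that(3,1)] by simp
        qed
        then show "constant_on_blocks (set Bs) (\<lambda>t. map f [0..<p] ! t)"
          "constant_on_blocks (set Cs) (\<lambda>t. map f [0..<p] ! t)"
          unfolding constant_on_blocks_def by blast+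
      qed
      then have "map f [0..<p] \<in> ?V" unfolding V by simp
      then obtain c where "map f [0..<p] = replicate p c" using L by blast
      then have "f t = c" if "t < p" for t
        using that by (metis (no_types) add_0 length_upt minus_nat.diff_0 nth_map nth_replicate nth_upt)
      then show "f x = f y" using xy by simp
    qed
  next
    assume R: "complementary_partitions {..<p} (set Bs) (set Cs)"
    show "\<forall>v\<in>?V. \<exists>c. v = replicate p c"
    proof
      fix v assume "v \<in> ?V"
      then have len: "length v = p" and eq: "\<And>x y. x \<in> {..<p} \<Longrightarrow> y \<in> {..<p} \<Longrightarrow> v ! x = v ! y"
        using R unfolding V complementary_partitions_def by blast+
      \<comment> \<open>For \<open>p = 0\<close> the value \<open>v ! 0\<close> is unspecified, but
        both sides are then the empty list.\<close>
      have "v = replicate p (v ! 0)"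
      proof (rule nth_equalityI)
        fix t assume t: "t < length v"
        have "v ! t = v ! 0" by (rule eq) (use t len in auto)
        also have "\<dots> = replicate p (v ! 0) ! t" using t len by simp
        finally show "v ! t = replicate p (v ! 0) ! t" .
      qed (simp add: len)
      then show "\<exists>c. v = replicate p c" ..
    qed
  qed
  finally show ?thesis .
qed

section \<open>Matrices of set partitions\<close>

lemma indicator_matrix_blocks:
  assumes "partition_on {..<p} P"
  obtains Bs where "indicator_matrix p P = map (indicator_column p) Bs" "distinct Bs" "set Bs = P"
proof
  let ?L = "sorted_list_of_set (sorted_list_of_set ` P)"
  have fin: "finite P" using finite_elements[OF _ assms] by simp
  have finB: "finite B" if "B \<in> P" for B
    using finite_subset[OF partition_on_block_subset[OF assms that]] by simp
  show "indicator_matrix p P = map (indicator_column p) (map set ?L)"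
    by (simp add: indicator_matrix_def indicator_column_def)
  have inv: "set (sorted_list_of_set B) = B" if "B \<in> P" for B using finB[OF that] by simp
  have set: "set ?L = sorted_list_of_set ` P" using fin by simp
  show "set (map set ?L) = P" using inv by (simp add: set image_image)
  have "inj_on set (sorted_list_of_set ` P)" using inv by (auto simp: inj_on_def)
  then show "distinct (map set ?L)" by (simp add: distinct_map set)
qed

lemma indicator_column_inject:
  assumes "B \<subseteq> {..<p}" "C \<subseteq> {..<p}" "indicator_column p B = indicator_column p C"
  shows "B = C"
proof -
  have "t \<in> B \<longleftrightarrow> t \<in> C" if "t < p" for t
    using arg_cong[OF assms(3), of "\<lambda>v. v ! t"] that by (simp split: if_splits)
  then show ?thesis using assms(1,2) by blast
qed

text \<open>Equal matrices have equal sets of columns, and an indicator column determines its block.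
  Sums over matrices thereby become sums over set partitions.\<close>

lemma inj_on_indicator_matrix: "inj_on (indicator_matrix p) {P. partition_on {..<p} P}"
proof (rule inj_onI)
  fix P Q assume P: "P \<in> {P. partition_on {..<p} P}" and Q: "Q \<in> {P. partition_on {..<p} P}"
    and eq: "indicator_matrix p P = indicator_matrix p Q"
  obtain Bs where Bs: "indicator_matrix p P = map (indicator_column p) Bs" "set Bs = P"
    using P indicator_matrix_blocks by blast
  obtain Cs where Cs: "indicator_matrix p Q = map (indicator_column p) Cs" "set Cs = Q"
    using Q indicator_matrix_blocks by blast
  have img: "indicator_column p ` P = indicator_column p ` Q"
    using arg_cong[OF eq, of set] Bs Cs by simp
  have "inj_on (indicator_column p) (Pow {..<p})"
    by (rule inj_onI, rule indicator_column_inject[where p = p]) auto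
  moreover have "P \<subseteq> Pow {..<p}" "Q \<subseteq> Pow {..<p}"
    using P Q partition_on_block_subset by blast+
  ultimately show "P = Q" using img by (simp add: inj_on_image_eq_iff)
qed

text \<open>The first partition comes as an arbitrary enumeration \<open>Bs\<close> of its blocks,
  so that \<open>canonical\<close> fits without being rewritten as an
  \<open>indicator_matrix\<close>.\<close>

lemma complements_eq_image:
  assumes "distinct Bs" "partition_on {..<p} (set Bs)"
  shows "complements p (map (indicator_column p) Bs) = indicator_matrix p `
    {Q. partition_on {..<p} Q \<and> complementary_partitions {..<p} (set Bs) Q}"
proof -
  have "complementary p (map (indicator_column p) Bs) (indicator_matrix p Q) \<longleftrightarrow>
      complementary_partitions {..<p} (set Bs) Q" if Q: "partition_on {..<p} Q" for Q
  proof -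
    obtain Cs where Cs: "indicator_matrix p Q = map (indicator_column p) Cs" "distinct Cs" "set Cs = Q"
      using indicator_matrix_blocks[OF Q] by blast
    then show ?thesis using complementary_indicator[OF assms, of Cs] Q by simp
  qed
  then show ?thesis unfolding complements_def ones_partitions_def by auto
qed

text \<open>Summing an indicator column over the positions with label \<open>k\<close> counts those
  positions in the block. Multisets are compared because \<open>reverse_transform\<close> sorts the
  columns.\<close>

lemma mset_reverse_transform:
  assumes "length \<sigma> = p" "\<And>B. B \<in> set Bs \<Longrightarrow> B \<subseteq> {..<p}"
  shows "mset (reverse_transform n \<sigma> (map (indicator_column p) Bs)) =
    image_mset (block_index n \<sigma>) (mset Bs)"
proof -
  have "(\<Sum>t | t < p \<and> \<sigma> ! t = k. indicator_column p B ! t) = card {t \<in> B. \<sigma> ! t = k}"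
    if "B \<in> set Bs" for B k
  proof -
    have "(\<Sum>t | t < p \<and> \<sigma> ! t = k. indicator_column p B ! t) =
        (\<Sum>t | t < p \<and> \<sigma> ! t = k. if t \<in> B then 1 else 0)" by (intro sum.cong) auto
    also have "\<dots> = card ({t. t < p \<and> \<sigma> ! t = k} \<inter> B)" by (simp add: sum.If_cases)
    also have "{t. t < p \<and> \<sigma> ! t = k} \<inter> B = {t \<in> B. \<sigma> ! t = k}" using assms(2)[OF that] by auto
    finally show ?thesis .
  qed
  then have "map (\<lambda>s. map (\<lambda>k. \<Sum>t | t < length \<sigma> \<and> \<sigma> ! t = k. s ! t) [0..<n])
      (map (indicator_column p) Bs) = map (block_index n \<sigma>) Bs"
    unfolding map_map by (intro map_cong) (auto simp: assms(1) block_index_def)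
  then show ?thesis by (simp only: reverse_transform_def mset_rev mset_sort mset_map)
qed

section \<open>The interval blocks of the canonical transformation\<close>

text \<open>The right end is written as the next left end, so that unions telescope; beyond the last
  column the interval is empty.\<close>

definition interval :: "columns \<Rightarrow> nat \<Rightarrow> nat set" where
  "interval \<Lambda> u = {sum_list (map sum_list (take u \<Lambda>))..<sum_list (map sum_list (take (Suc u) \<Lambda>))}"

lemma sum_list_take_Suc:
  "u < length \<Lambda> \<Longrightarrow> sum_list (map sum_list (take (Suc u) \<Lambda>)) =
    sum_list (map sum_list (take u \<Lambda>)) + sum_list (\<Lambda> ! u)"
  by (simp add: take_Suc_conv_app_nth)

lemma canonical_eq_intervals:
  "canonical \<Lambda> = map (indicator_column (sum_list (map sum_list \<Lambda>))) (map (interval \<Lambda>) [0..<length \<Lambda>])"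
  by (simp add: canonical_def Let_def indicator_column_def interval_def sum_list_take_Suc)

text \<open>Positive column sums make the partial sums strictly increasing, so the intervals are
  nonempty and disjoint, hence distinct.\<close>

lemma partition_on_intervals:
  assumes pos: "\<And>c. c \<in> set \<Lambda> \<Longrightarrow> sum_list c > (0::nat)"
  shows "inj_on (interval \<Lambda>) {..<length \<Lambda>}"
    and "partition_on {..<sum_list (map sum_list \<Lambda>)} (interval \<Lambda> ` {..<length \<Lambda>})"
proof -
  define s where "s u = sum_list (map sum_list (take u \<Lambda>))" for u
  have I: "interval \<Lambda> u = {s u..<s (Suc u)}" for u by (simp add: interval_def s_def)
  have less: "s u < s (Suc u)" if "u < length \<Lambda>" for u
    using that pos by (simp add: s_def sum_list_take_Suc)
  have "s u \<le> s (Suc u)" for u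
    using less[of u] by (cases "u < length \<Lambda>") (auto simp: s_def)
  then have mono: "s u \<le> s v" if "u \<le> v" for u v using lift_Suc_mono_le that by blast
  have disj: "disjnt (interval \<Lambda> u) (interval \<Lambda> v)" if "u \<noteq> v" for u v
  proof -
    have "disjnt (interval \<Lambda> u) (interval \<Lambda> v)" if "u < v" for u v
      using mono[of "Suc u" v] that by (auto simp: I disjnt_iff)
    then show ?thesis using that by (metis disjnt_sym nat_neq_iff)
  qed
  have ne: "interval \<Lambda> u \<noteq> {}" if "u < length \<Lambda>" for u using less[OF that] by (simp add: I)
  show "inj_on (interval \<Lambda>) {..<length \<Lambda>}"
  proof (rule inj_onI, rule ccontr)
    fix u v assume "u \<in> {..<length \<Lambda>}" "interval \<Lambda> u = interval \<Lambda> v" "u \<noteq> v"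
    then show False using disj[of u v] ne[of u] by simp
  qed
  have "(\<Union>u<k. interval \<Lambda> u) = {..<s k}" for k
  proof (induction k)
    case (Suc k)
    then show ?case using mono[of k "Suc k"] by (auto simp: lessThan_Suc I)
  qed (simp add: s_def)
  from this[of "length \<Lambda>"] have U: "(\<Union>u<length \<Lambda>. interval \<Lambda> u) = {..<sum_list (map sum_list \<Lambda>)}"
    by (simp add: s_def)
  show "partition_on {..<sum_list (map sum_list \<Lambda>)} (interval \<Lambda> ` {..<length \<Lambda>})"
  proof (rule partition_onI)
    show "\<Union> (interval \<Lambda> ` {..<length \<Lambda>}) = {..<sum_list (map sum_list \<Lambda>)}" by (rule U)
    show "{} \<notin> interval \<Lambda> ` {..<length \<Lambda>}" using ne by (metis imageE lessThan_iff)
    show "disjnt p q" if pq: "p \<in> interval \<Lambda> ` {..<length \<Lambda>}" "q \<in> interval \<Lambda> ` {..<length \<Lambda>}" "p \<noteq> q"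
      for p q
    proof -
      obtain u v where uv: "p = interval \<Lambda> u" "q = interval \<Lambda> v" using pq(1,2) by (elim imageE)
      then have "u \<noteq> v" using pq(3) by blast
      then show ?thesis unfolding uv by (rule disj)
    qed
  qed
qed

text \<open>Counts the positions with label \<open>k\<close> block by block. Used both ways: to read
  the fibre sizes of \<open>\<sigma>\<close> off one partition, and to get the row sums of the image
  of any other.\<close>

lemma sum_block_index:
  assumes P: "partition_on {..<p} P" and k: "k < n"
  shows "(\<Sum>B\<in>P. block_index n \<sigma> B ! k) = card {t. t < p \<and> \<sigma> ! t = k}"
proof -
  have finB: "finite B" if "B \<in> P" for B
    using finite_subset[OF partition_on_block_subset[OF P that]] by simp
  have "(\<Sum>B\<in>P. block_index n \<sigma> B ! k) = (\<Sum>B\<in>P. \<Sum>t\<in>B. if \<sigma> ! t = k then 1 else 0)"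
    using finB k by (intro sum.cong) (auto simp: sum.If_cases Int_def)
  also have "\<dots> = (\<Sum>t<p. if \<sigma> ! t = k then 1 else 0)"
    by (rule sum.partition[OF _ P, symmetric]) simp
  also have "\<dots> = card {t. t < p \<and> \<sigma> ! t = k}" by (simp add: sum.If_cases Int_def)
  finally show ?thesis .
qed

lemma mi_partitions_positive:
  assumes "\<Lambda> \<in> mi_partitions i" "c \<in> set \<Lambda>"
  shows "sum_list c > 0"
proof -
  obtain k where "k < length c" "c ! k \<noteq> 0" using assms by (fastforce simp: mi_partitions_def)
  then have "0 < c ! k" "c ! k \<le> sum_list c" by (simp_all add: elem_le_sum_list)
  then show ?thesis by (rule less_le_trans)
qed

text \<open>Adding the entries by rows and by columns shows that the number of positions used inside
  \<open>canonical\<close> is the modulus of \<open>i\<close>.\<close>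

lemma sum_list_mi_partition:
  assumes "\<Lambda> \<in> mi_partitions i"
  shows "sum_list (map sum_list \<Lambda>) = sum_list i"
proof -
  have "map sum_list \<Lambda> = map (\<lambda>c. \<Sum>k<length i. c ! k) \<Lambda>"
    using assms by (auto simp: mi_partitions_def sum_list_sum_nth atLeast0LessThan)
  then have "sum_list (map sum_list \<Lambda>) = (\<Sum>k<length i. \<Sum>c\<leftarrow>\<Lambda>. c ! k)"
    by (simp add: sum_list_sum_nth) (rule sum.swap)
  also have "\<dots> = sum_list i"
    using assms by (simp add: mi_partitions_def sum_list_sum_nth atLeast0LessThan)
  finally show ?thesis .
qed

text \<open>Passes from distinct columns with multiplicities to columns with repetition, which
  correspond to the blocks of a set partition.\<close>

lemma prod_power_count_list:
  fixes f :: "'b \<Rightarrow> real"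
  shows "(\<Prod>c\<in>set xs. f c ^ count_list xs c) = prod_mset (image_mset f (mset xs))"
  by (simp add: image_prod_mset_multiplicity count_mset)

lemma sum_card_fibres:
  fixes F :: "'b \<Rightarrow> real"
  assumes "finite A" "finite T" "g ` A \<subseteq> T"
  shows "(\<Sum>y\<in>T. real (card {x \<in> A. g x = y}) * F y) = (\<Sum>x\<in>A. F (g x))"
proof -
  have "(\<Sum>y\<in>T. real (card {x \<in> A. g x = y}) * F y) = (\<Sum>y\<in>T. \<Sum>x | x \<in> A \<and> g x = y. F (g x))"
    by (intro sum.cong) auto
  also have "\<dots> = (\<Sum>x\<in>A. F (g x))" by (rule sum.group[OF assms])
  finally show ?thesis .
qed

subsection \<open>The expansion for a labeling that recovers the columns\<close>

text \<open>The fibre sizes \<open>fib\<close> give the right row sums, and the label of any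
  position in a block marks a nonzero entry of its column.\<close>

lemma reverse_transform_in_mi_partitions:
  assumes len: "length \<sigma> = p" and \<sigma>: "\<And>t. t < p \<Longrightarrow> \<sigma> ! t < length i"
    and fib: "\<And>k. k < length i \<Longrightarrow> card {t. t < p \<and> \<sigma> ! t = k} = i ! k"
    and Q: "partition_on {..<p} Q"
  shows "reverse_transform (length i) \<sigma> (indicator_matrix p Q) \<in> mi_partitions i"
    and "mset (reverse_transform (length i) \<sigma> (indicator_matrix p Q)) =
      image_mset (block_index (length i) \<sigma>) (mset_set Q)"
proof -
  let ?L = "reverse_transform (length i) \<sigma> (indicator_matrix p Q)"
  obtain Cs where Cs: "indicator_matrix p Q = map (indicator_column p) Cs" "distinct Cs" "set Cs = Q"
    using indicator_matrix_blocks[OF Q] by blast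
  have sub: "B \<subseteq> {..<p}" if "B \<in> Q" for B using partition_on_block_subset[OF Q that] .
  show m: "mset ?L = image_mset (block_index (length i) \<sigma>) (mset_set Q)"
    using mset_reverse_transform[OF len, of Cs] sub mset_set_set[OF Cs(2)] Cs by simp
  have finQ: "finite Q" using finite_elements[OF _ Q] by simp
  have "set ?L = set_mset (mset ?L)" by simp
  also have "\<dots> = block_index (length i) \<sigma> ` Q" unfolding m using finQ by simp
  finally have set: "set ?L = block_index (length i) \<sigma> ` Q" .
  have "length c = length i \<and> (\<exists>k<length i. c ! k \<noteq> 0)" if c: "c \<in> set ?L" for c
  proof -
    obtain B where B: "B \<in> Q" "c = block_index (length i) \<sigma> B" using c set by auto
    obtain t where t: "t \<in> B" using partition_on_block_nonempty[OF Q B(1)] by blast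
    then have k: "\<sigma> ! t < length i" using \<sigma> sub[OF B(1)] by auto
    have "finite B" using finite_subset[OF sub[OF B(1)]] by simp
    then have "card {s \<in> B. \<sigma> ! s = \<sigma> ! t} \<noteq> 0" using t by auto
    then show ?thesis using k B(2) by auto
  qed
  moreover have "(\<Sum>c\<leftarrow>?L. c ! k) = i ! k" if k: "k < length i" for k
  proof -
    have "(\<Sum>c\<leftarrow>?L. c ! k) = sum_mset (image_mset (\<lambda>c. c ! k) (mset ?L))"
      by (metis mset_map sum_mset_sum_list)
    also have "\<dots> = (\<Sum>B\<in>Q. block_index (length i) \<sigma> B ! k)"
      unfolding m by (simp add: image_mset.compositionality comp_def sum_unfold_sum_mset)
    also have "\<dots> = i ! k" unfolding sum_block_index[OF Q k] by (rule fib[OF k])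
    finally show ?thesis .
  qed
  moreover have "sorted_wrt (\<ge>) ?L" by (simp add: reverse_transform_def sorted_wrt_rev)
  ultimately show "?L \<in> mi_partitions i" by (simp add: mi_partitions_def)
qed

text \<open>The column of a block stands for the product of the labelled variables over it, and
  products over disjoint blocks combine into the product over their union.\<close>

lemma generalized_cumulant_blocks:
  assumes P: "partition_on A P" and A: "finite A" and \<sigma>: "\<And>t. t \<in> A \<Longrightarrow> \<sigma> ! t < n"
    and \<Lambda>: "mset \<Lambda> = image_mset (block_index n \<sigma>) (mset_set P)"
  shows "generalized_cumulant M X \<Lambda> =
    set_cumulant (\<lambda>S. integral\<^sup>L M (\<lambda>\<omega>. \<Prod>t\<in>\<Union>S. X (\<sigma> ! t) \<omega>)) P"
proof -
  have finP: "finite P" using finite_elements[OF A P] .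
  have sub: "B \<subseteq> A" if "B \<in> P" for B using partition_on_block_subset[OF P that] .
  have finB: "finite B" if "B \<in> P" for B using finite_subset[OF sub[OF that] A] .
  have "mset (map (mpower X) \<Lambda>) = image_mset (\<lambda>B. mpower X (block_index n \<sigma> B)) (mset_set P)"
    using \<Lambda> by (simp add: image_mset.compositionality comp_def)
  from joint_cumulant_mset_set[OF finP this]
  have "generalized_cumulant M X \<Lambda> = set_cumulant
      (\<lambda>S. integral\<^sup>L M (\<lambda>\<omega>. \<Prod>B\<in>S. mpower X (block_index n \<sigma> B) \<omega>)) P"
    by (simp add: generalized_cumulant_def)
  also have "\<dots> = set_cumulant (\<lambda>S. integral\<^sup>L M (\<lambda>\<omega>. \<Prod>t\<in>\<Union>S. X (\<sigma> ! t) \<omega>)) P"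
  proof (rule set_cumulant_cong)
    fix S assume S: "S \<subseteq> P"
    have "(\<Prod>B\<in>S. mpower X (block_index n \<sigma> B) \<omega>) = (\<Prod>t\<in>\<Union>S. X (\<sigma> ! t) \<omega>)" for \<omega>
    proof -
      have "(\<Prod>B\<in>S. mpower X (block_index n \<sigma> B) \<omega>) = (\<Prod>B\<in>S. \<Prod>t\<in>B. X (\<sigma> ! t) \<omega>)"
        using S finB sub \<sigma> by (intro prod.cong refl mpower_block_index) blast+
      also have "\<dots> = (\<Prod>t\<in>\<Union>S. X (\<sigma> ! t) \<omega>)"
      proof (rule trans[OF _ prod.Union_disjoint[symmetric]])
        show "\<forall>B\<in>S. finite B" using S finB by blast
        show "\<forall>B\<in>S. \<forall>C\<in>S. B \<noteq> C \<longrightarrow> B \<inter> C = {}"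
          using S partition_onD2[OF P] by (meson disjointD subsetD)
      qed simp
      finally show ?thesis .
    qed
    then show "integral\<^sup>L M (\<lambda>\<omega>. \<Prod>B\<in>S. mpower X (block_index n \<sigma> B) \<omega>) =
        integral\<^sup>L M (\<lambda>\<omega>. \<Prod>t\<in>\<Union>S. X (\<sigma> ! t) \<omega>)" by simp
  qed
  finally show ?thesis .
qed

text \<open>The hypothesis \<open>rt\<close> makes the columns of \<open>\<Lambda>\<close> the
  multi-indices of the intervals, so that \<open>generalized_cumulant\<close> is a cumulant of block
  products. The Leonov--Shiryaev sum is then grouped by the image of each complement, and the fibre
  sizes are the coefficients.\<close>

lemma generalized_cumulant_expansion:
  assumes \<Lambda>: "\<Lambda> \<in> mi_partitions i" and len: "length \<sigma> = sum_list i"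
    and \<sigma>: "\<And>t. t < sum_list i \<Longrightarrow> \<sigma> ! t < length i"
    and rt: "reverse_transform (length i) \<sigma> (canonical \<Lambda>) = \<Lambda>"
  shows "generalized_cumulant M X \<Lambda> =
    (\<Sum>\<Lambda>'\<in>complement_images i \<sigma> (canonical \<Lambda>).
       real (complement_count i \<sigma> (canonical \<Lambda>) \<Lambda>') *
       (\<Prod>c\<in>set \<Lambda>'. multivariate_cumulant M X c ^ count_list \<Lambda>' c))"
proof -
  define p where "p = sum_list i"
  define n where "n = length i"
  define Is where "Is = map (interval \<Lambda>) [0..<length \<Lambda>]"
  define m where "m C = integral\<^sup>L M (\<lambda>\<omega>. \<Prod>t\<in>C. X (\<sigma> ! t) \<omega>)" for C
  define F where "F \<Lambda>' = (\<Prod>c\<in>set \<Lambda>'. multivariate_cumulant M X c ^ count_list \<Lambda>' c)" for \<Lambda>'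
  note len = len[folded p_def] and \<sigma> = \<sigma>[folded p_def n_def] and rt = rt[folded n_def]
  have intervals: "inj_on (interval \<Lambda>) {..<length \<Lambda>}"
    "partition_on {..<sum_list (map sum_list \<Lambda>)} (interval \<Lambda> ` {..<length \<Lambda>})"
    using partition_on_intervals[of \<Lambda>] mi_partitions_positive[OF \<Lambda>] by blast+
  have can: "canonical \<Lambda> = map (indicator_column p) Is"
    by (simp add: canonical_eq_intervals sum_list_mi_partition[OF \<Lambda>] Is_def p_def)
  have dist: "distinct Is" using intervals(1) by (simp add: Is_def distinct_map atLeast0LessThan)
  have setI: "set Is = interval \<Lambda> ` {..<length \<Lambda>}" by (simp add: Is_def atLeast0LessThan)
  have P: "partition_on {..<p} (set Is)"
    using intervals(2) by (simp add: setI sum_list_mi_partition[OF \<Lambda>] p_def)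
  have m\<Lambda>: "mset \<Lambda> = image_mset (block_index n \<sigma>) (mset_set (set Is))"
    using mset_reverse_transform[OF len partition_on_block_subset[OF P], of Is n] rt
    by (simp add: can mset_set_set[OF dist])
  \<comment> \<open>The intervals already map to \<open>\<Lambda>\<close>, whose row sums are
    \<open>i\<close>; this fixes the fibre sizes of \<open>\<sigma>\<close>.\<close>
  have fib: "card {t. t < p \<and> \<sigma> ! t = k} = i ! k" if k: "k < n" for k
  proof -
    have "i ! k = (\<Sum>c\<leftarrow>\<Lambda>. c ! k)" using \<Lambda> k by (simp add: mi_partitions_def n_def)
    also have "\<dots> = sum_mset (image_mset (\<lambda>c. c ! k) (mset \<Lambda>))"
      by (metis mset_map sum_mset_sum_list)
    also have "\<dots> = (\<Sum>B\<in>set Is. block_index n \<sigma> B ! k)"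
      unfolding m\<Lambda> by (simp add: image_mset.compositionality comp_def sum_unfold_sum_mset)
    finally show ?thesis unfolding sum_block_index[OF P k] by simp
  qed
  let ?D = "{Q. partition_on {..<p} Q \<and> complementary_partitions {..<p} (set Is) Q}"
  let ?g = "reverse_transform n \<sigma>"
  have comp: "complements p (canonical \<Lambda>) = indicator_matrix p ` ?D"
    unfolding can by (rule complements_eq_image[OF dist P])
  have finD: "finite ?D" by (rule finite_subset[OF _ finitely_many_partition_on[of "{..<p}"]]) auto
  have mi: "?g (indicator_matrix p Q) \<in> mi_partitions i"
    "mset (?g (indicator_matrix p Q)) = image_mset (block_index n \<sigma>) (mset_set Q)"
    if "partition_on {..<p} Q" for Q
    using reverse_transform_in_mi_partitions[OF len, of i, folded n_def, OF _ _ that] \<sigma> fib by blast+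
  have "?g S \<in> mi_partitions i" if "S \<in> complements p (canonical \<Lambda>)" for S
    using that mi(1) unfolding comp by auto
  \<comment> \<open>Every image lies in \<open>mi_partitions i\<close>, so the restriction in
    \<open>complement_images\<close> discards nothing.\<close>
  then have images: "complement_images i \<sigma> (canonical \<Lambda>) = ?g ` complements p (canonical \<Lambda>)"
    unfolding complement_images_def p_def n_def by blast
  have count: "complement_count i \<sigma> (canonical \<Lambda>) \<Lambda>' = card {S \<in> complements p (canonical \<Lambda>). ?g S = \<Lambda>'}"
    for \<Lambda>'
    unfolding complement_count_def p_def n_def complements_def by (rule arg_cong[where f = card]) blast
  have F: "F (?g (indicator_matrix p Q)) = (\<Prod>B\<in>Q. set_cumulant m B)" if Q: "partition_on {..<p} Q" for Q
  proof -
    have "F (?g (indicator_matrix p Q)) = (\<Prod>B\<in>Q. multivariate_cumulant M X (block_index n \<sigma> B))"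
      unfolding F_def prod_power_count_list mi(2)[OF Q]
      by (simp add: image_mset.compositionality comp_def prod_unfold_prod_mset)
    also have "\<dots> = (\<Prod>B\<in>Q. set_cumulant m B)"
    proof (rule prod.cong[OF refl])
      fix B assume "B \<in> Q"
      then have "B \<subseteq> {..<p}" using partition_on_block_subset[OF Q] by blast
      then show "multivariate_cumulant M X (block_index n \<sigma> B) = set_cumulant m B"
        unfolding m_def using finite_subset[of B "{..<p}"] \<sigma>
        by (intro multivariate_cumulant_block_index) auto
    qed
    finally show ?thesis .
  qed
  have "generalized_cumulant M X \<Lambda> = set_cumulant (\<lambda>S. m (\<Union>S)) (set Is)"
    unfolding m_def using \<sigma> by (intro generalized_cumulant_blocks[OF P _ _ m\<Lambda>]) auto
  also have "\<dots> = (\<Sum>Q\<in>?D. \<Prod>B\<in>Q. set_cumulant m B)" by (rule leonov_shiryaev[OF _ P]) simp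
  also have "\<dots> = (\<Sum>Q\<in>?D. F (?g (indicator_matrix p Q)))" using F by (intro sum.cong) auto
  also have "\<dots> = (\<Sum>S\<in>complements p (canonical \<Lambda>). F (?g S))"
    unfolding comp using inj_on_subset[OF inj_on_indicator_matrix, of ?D p]
    by (subst sum.reindex) auto
  also have "\<dots> = (\<Sum>\<Lambda>'\<in>?g ` complements p (canonical \<Lambda>).
      real (card {S \<in> complements p (canonical \<Lambda>). ?g S = \<Lambda>'}) * F \<Lambda>')"
    using finD by (intro sum_card_fibres[symmetric]) (auto simp: comp)
  finally show ?thesis unfolding images count F_def .
qed

subsection \<open>The two labelings\<close>

lemma nth_labeling_less:
  assumes "t < sum_list i"
  shows "labeling i ! t < length i"
proof -
  have "labeling i ! t \<in> set (labeling i)" using assms by (intro nth_mem) (simp add: length_labeling)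
  then show ?thesis by (auto simp: labeling_def)
qed

section \<open>The columnwise labeling recovers the columns\<close>

lemma length_columnwise_labeling:
  "length (columnwise_labeling \<Lambda>) = sum_list (map sum_list \<Lambda>)"
  by (induction \<Lambda>) (simp_all add: columnwise_labeling_def length_labeling)

lemma nth_columnwise_labeling:
  assumes u: "u < length \<Lambda>" and j: "j < sum_list (\<Lambda> ! u)"
  shows "columnwise_labeling \<Lambda> ! (sum_list (map sum_list (take u \<Lambda>)) + j) = labeling (\<Lambda> ! u) ! j"
proof -
  have "columnwise_labeling \<Lambda> = columnwise_labeling (take u \<Lambda>) @ labeling (\<Lambda> ! u) @
      columnwise_labeling (drop (Suc u) \<Lambda>)"
    by (subst id_take_nth_drop[OF u]) (simp add: columnwise_labeling_def)
  then show ?thesis using j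
    by (simp add: nth_append length_columnwise_labeling length_labeling)
qed

lemma columnwise_labeling_less:
  assumes "t \<in> {..<sum_list (map sum_list \<Lambda>)}" "\<And>c. c \<in> set \<Lambda> \<Longrightarrow> length c = n"
  shows "columnwise_labeling \<Lambda> ! t < n"
proof -
  have "columnwise_labeling \<Lambda> ! t \<in> set (columnwise_labeling \<Lambda>)"
    using assms(1) by (intro nth_mem) (simp add: length_columnwise_labeling)
  then show ?thesis using assms(2) by (auto simp: columnwise_labeling_def labeling_def)
qed

text \<open>The positions of the \<open>u\<close>-th interval with label \<open>k\<close> are a
  shifted copy of the \<open>k\<close>-th fibre of \<open>labeling (\<Lambda> ! u)\<close>, whose
  size is the \<open>k\<close>-th entry of that column.\<close>

lemma block_index_columnwise:
  assumes u: "u < length \<Lambda>" and n: "length (\<Lambda> ! u) = n"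
  shows "block_index n (columnwise_labeling \<Lambda>) (interval \<Lambda> u) = \<Lambda> ! u"
proof (rule nth_equalityI)
  fix k assume "k < length (block_index n (columnwise_labeling \<Lambda>) (interval \<Lambda> u))"
  then have k: "k < length (\<Lambda> ! u)" using n by simp
  let ?s = "sum_list (map sum_list (take u \<Lambda>))" and ?c = "\<Lambda> ! u"
  let ?T = "{t \<in> interval \<Lambda> u. columnwise_labeling \<Lambda> ! t = k}"
  have T: "?T = (+) ?s ` {j. j < sum_list ?c \<and> labeling ?c ! j = k}"
  proof (intro equalityI subsetI)
    fix t assume t: "t \<in> ?T"
    then have "t = ?s + (t - ?s)" "t - ?s < sum_list ?c"
      by (auto simp: interval_def sum_list_take_Suc[OF u])
    then show "t \<in> (+) ?s ` {j. j < sum_list ?c \<and> labeling ?c ! j = k}"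
      using t nth_columnwise_labeling[OF u, of "t - ?s"] by (intro image_eqI[of _ _ "t - ?s"]) auto
  next
    fix t assume "t \<in> (+) ?s ` {j. j < sum_list ?c \<and> labeling ?c ! j = k}"
    then show "t \<in> ?T"
      using nth_columnwise_labeling[OF u] by (auto simp: interval_def sum_list_take_Suc[OF u])
  qed
  have "card ?T = card {j. j < sum_list ?c \<and> labeling ?c ! j = k}"
    unfolding T by (rule card_image) simp
  also have "\<dots> = ?c ! k" unfolding labeling_fibre[OF k] using k by (simp add: take_Suc_conv_app_nth)
  finally show "block_index n (columnwise_labeling \<Lambda>) (interval \<Lambda> u) ! k = ?c ! k"
    using k n by simp
qed (simp add: n)

lemma reverse_transform_columnwise:
  assumes \<Lambda>: "\<Lambda> \<in> mi_partitions i"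
  shows "reverse_transform (length i) (columnwise_labeling \<Lambda>) (canonical \<Lambda>) = \<Lambda>"
proof -
  let ?p = "sum_list (map sum_list \<Lambda>)" and ?R = "reverse_transform (length i) (columnwise_labeling \<Lambda>)"
  have len: "length (\<Lambda> ! u) = length i" if "u < length \<Lambda>" for u
    using \<Lambda> that by (simp add: mi_partitions_def)
  have "partition_on {..<?p} (interval \<Lambda> ` {..<length \<Lambda>})"
    using partition_on_intervals(2)[of \<Lambda>] mi_partitions_positive[OF \<Lambda>] by blast
  then have sub: "B \<subseteq> {..<?p}" if "B \<in> set (map (interval \<Lambda>) [0..<length \<Lambda>])" for B
    using that partition_on_block_subset by (simp add: atLeast0LessThan)
  have "mset (?R (canonical \<Lambda>)) = image_mset (block_index (length i) (columnwise_labeling \<Lambda>))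
      (mset (map (interval \<Lambda>) [0..<length \<Lambda>]))"
    unfolding canonical_eq_intervals by (rule mset_reverse_transform[OF length_columnwise_labeling sub])
  also have "\<dots> = mset (map (\<lambda>u. block_index (length i) (columnwise_labeling \<Lambda>) (interval \<Lambda> u))
      [0..<length \<Lambda>])"
    by (simp add: multiset.map_comp comp_def)
  also have "map (\<lambda>u. block_index (length i) (columnwise_labeling \<Lambda>) (interval \<Lambda> u)) [0..<length \<Lambda>] =
      map (\<lambda>u. \<Lambda> ! u) [0..<length \<Lambda>]"
    using len by (intro map_cong refl block_index_columnwise) auto
  also have "\<dots> = \<Lambda>" by (rule map_nth)
  finally have m: "mset (?R (canonical \<Lambda>)) = mset \<Lambda>" .
  \<comment> \<open>Two decreasing lists with the same multiset are equal; uniqueness of sorting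
    concerns increasing lists, hence the reversals.\<close>
  have "sorted (rev \<Lambda>)" using \<Lambda> by (simp add: mi_partitions_def sorted_wrt_rev)
  moreover have "sorted (rev (?R (canonical \<Lambda>)))" by (simp add: reverse_transform_def)
  ultimately have "rev (?R (canonical \<Lambda>)) = rev \<Lambda>"
    using m by (metis mset_rev properties_for_sort)
  then show ?thesis by simp
qed

text \<open>Both expansions are instances of \<open>generalized_cumulant_expansion\<close>. Recovery
  of \<open>\<Lambda>\<close> from \<open>canonical \<Lambda>\<close> is the premise of the first
  and holds for every \<open>\<Lambda> \<in> mi_partitions i\<close> in the second.\<close>

theorem theorem4p2:
  fixes M :: "'a measure" and X :: "nat \<Rightarrow> 'a \<Rightarrow> real"
    and n :: nat and i :: multi_index and \<Lambda> :: columns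
  assumes "prob_space M"
    and "length i = n"
    and "\<forall>k<n. X k \<in> borel_measurable M"
    and "\<forall>j. length j = n \<and> (\<forall>k<n. j ! k \<le> i ! k) \<longrightarrow> integrable M (mpower X j)"
    and "\<Lambda> \<in> mi_partitions i"
  shows
    "(reverse_transform n (labeling i) (canonical \<Lambda>) = \<Lambda> \<longrightarrow>
        generalized_cumulant M X \<Lambda> =
          (\<Sum>\<Lambda>'\<in>complement_images i (labeling i) (canonical \<Lambda>).
             real (complement_count i (labeling i) (canonical \<Lambda>) \<Lambda>') *
             (\<Prod>c\<in>set \<Lambda>'. multivariate_cumulant M X c ^ count_list \<Lambda>' c))) \<and>
     generalized_cumulant M X \<Lambda> =
       (\<Sum>\<Lambda>'\<in>complement_images i (columnwise_labeling \<Lambda>) (canonical \<Lambda>).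
          real (complement_count i (columnwise_labeling \<Lambda>) (canonical \<Lambda>) \<Lambda>') *
          (\<Prod>c\<in>set \<Lambda>'. multivariate_cumulant M X c ^ count_list \<Lambda>' c))"
proof (intro conjI impI)
  assume "reverse_transform n (labeling i) (canonical \<Lambda>) = \<Lambda>"
  then show "generalized_cumulant M X \<Lambda> =
      (\<Sum>\<Lambda>'\<in>complement_images i (labeling i) (canonical \<Lambda>).
         real (complement_count i (labeling i) (canonical \<Lambda>) \<Lambda>') *
         (\<Prod>c\<in>set \<Lambda>'. multivariate_cumulant M X c ^ count_list \<Lambda>' c))"
    using assms(2) by (intro generalized_cumulant_expansion[OF assms(5) length_labeling nth_labeling_less]) simp_all
next
  have "columnwise_labeling \<Lambda> ! t < length i" if "t < sum_list i" for t
    using assms(5) that sum_list_mi_partition[OF assms(5)]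
    by (intro columnwise_labeling_less) (auto simp: mi_partitions_def)
  then show "generalized_cumulant M X \<Lambda> =
      (\<Sum>\<Lambda>'\<in>complement_images i (columnwise_labeling \<Lambda>) (canonical \<Lambda>).
         real (complement_count i (columnwise_labeling \<Lambda>) (canonical \<Lambda>) \<Lambda>') *
         (\<Prod>c\<in>set \<Lambda>'. multivariate_cumulant M X c ^ count_list \<Lambda>' c))"
    using sum_list_mi_partition[OF assms(5)]
    by (intro generalized_cumulant_expansion[OF assms(5) _ _ reverse_transform_columnwise[OF assms(5)]])
       (simp_all add: length_columnwise_labeling)
qed

end
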